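(* (The algorithm ALG decides resource bisimilarity.) Let $N=(P,T,W,l)$ be a labeled Petri net with $P\neq\emptyset$ and $T\neq\emptyset$, and let $r_0,s_0\in\mathcal{M}(P)$ be resources of $N$. Let ALG be the nondeterministic algorithm described in the context. Then: (1) For the input $N,r_0,s_0$ there are only finitely many computations of ALG, and each computation finishes by constructing a finite tree $\mathcal{T}$ whose nodes are labeled with pairs of resources; moreover, either one leaf of $\mathcal{T}$ is unsuccessful, i.e. labeled with a pair $(r,s)$ where $r\not\simeq_1 s$ (in which case the computation returns NO), or $\mathcal{T}$ is successful, i.e. all leaves of $\mathcal{T}$ are identity-nodes (in which case the computation returns YES). (2) We have $r_0\simeq s_0$ if and only if at least one computation of ALG on $N,r_0,s_0$ constructs a successful tree.
   Context: **Multisets.** For a finite set $P$, $\mathcal{M}(P)$ is the set of multisets over $P$, i.e. maps $m:P\to\mathbb{N}$ (with $0\in\mathbb N$). Operations and order are componentwise: $(m+m')(p)=m(p)+m'(p)$, $(m-m')(p)=\max\{m(p)-m'(p),0\}$ (truncated subtraction), and $m\le m'$ iff $m(p)\le m'(p)$ for all $p$. The cardinality is $|m|=\sum_{p}m(p)$. Fix a total order on $P$, so multisets are vectors in $\mathbb{N}^{|P|}$. We write $m<_{\mathrm{lex}}m'$ if $m\ne m'$ and $m$ is smaller than $m'$ at the least coordinate where they differ. For pairs, $(r',s')\le(r,s)$ means $r'\le r$ and $s'\le s$. **Labeled Petri nets.** A labeled Petri net is $N=(P,T,W,l)$ with finite disjoint sets $P$ (places) and $T$ (transitions), $W:(P\times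 T)\cup(T\times P)\to\mathbb{N}$, and $l:T\to\mathrm{Act}$ a labeling by actions from a set $\mathrm{Act}$. Markings, also called resources, are elements of $\mathcal{M}(P)$. For $t\in T$, the multisets ${}^\bullet t,t^\bullet\in\mathcal{M}(P)$ are given by ${}^\bullet t(p)=W(p,t)$ and $t^\bullet(p)=W(t,p)$. If ${}^\bullet t\le M$ then $t$ may fire in $M$, written $M\xrightarrow{t}M'$, where $M'=(M-{}^\bullet t)+t^\bullet$. **Resource bisimilarity.** A relation $R\subseteq\mathcal{M}(P)\times\mathcal{M}(P)$ satisfies the resource transfer property w.r.t. $R'\subseteq\mathcal{M}(P)\times\mathcal{M}(P)$ if for each $(r,s)\in R$ and each $t\in T$ with firing $(r+({}^\bullet t-r))\xrightarrow{t}r'$ there is a firing $(s+({}^\bullet t-r))\xrightarrow{u}s'$ with $u\in T$, $l(u)=l(t)$ and $(r',s')\in R'$. $R$ is a resource bisimulation if $R$ satisfies this property w.r.t. $R$, and $R^{-1}$ satisfies it w.r.t. $R^{-1}$. We write $r\simeq s$ if $(r,s)$ belongs to some resource bisimulation. The relation $\simeq_1$ is the largest symmetric relation on $\mathcal{M}(P)$ satisfying the resource transfer property w.r.t. the full relation $\mathcal{M}(P)\times\mathcal{M}(P)$. **$t$-children.** For $t\in T$ and $r,s\in\mathcal{M}(P)$, $\mathrm{next}_t(r,s)$ is the set of all pairs $(r',s')$ such that $(r+({}^\bullet t-r))\xrightarrow{t}r'$ and $(s+({}^\bullet t-r))\xrightarrow{u}s'$ for some $u\in T$ with $l(u)=l(t)$.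 One has $r\not\simeq_1 s$ iff $\mathrm{next}_t(r,s)=\emptyset$ or $\mathrm{next}_t(s,r)=\emptyset$ for some $t\in T$. **Algorithm ALG** (nondeterministic; input $N,r_0,s_0$). It maintains a finite rooted tree, the current tree, whose nodes are labeled with pairs of resources. A node is an identity-node if its label has the form $(r,r)$. Initially the tree consists of a root labeled $(r_0,s_0)$. While the tree has a leaf that is not an identity-node, choose such a leaf $\mathsf{n}$, labeled $(r,s)$ with $r\ne s$. If REDUCE is applicable to $\mathsf{n}$, apply REDUCE to it; otherwise apply EXPAND to it. When all leaves are identity-nodes, return YES. *REDUCE.* It is applicable to $\mathsf{n}$ iff on the path from the root to $\mathsf{n}$ there is a node $\mathsf{n}'\ne\mathsf{n}$ with label $(r',s')\le(r,s)$. If applicable, one such $\mathsf{n}'$ with label $(r',s')$ is selected (necessarily $r'\neq s'$), and $\mathsf{n}$ gets exactly one child, labeled as follows. - If $|r'|<|s'|$, or $|r'|=|s'|$ and $r'<_{\mathrm{lex}}s'$, the label is $(r,(s-s')+r')$. - If $|s'|<|r'|$, or $|r'|=|s'|$ and $s'<_{\mathrm{lex}}r'$, the label is $((r-r')+s',s)$. *EXPAND.* If $r\not\simeq_1 s$, the whole computation stops and returns NO. Otherwise, for each $t\in T$, nondeterministically select exactly one pair from $\mathrm{next}_t(r,s)$ and exactly one pair from $\mathrm{next}_t(s,r)$, and create (at most $2\cdot|T|$) children of $\mathsf{n}$ whose labels are precisely the pairs selected for all $t\in T$. A computation is a run of ALG resolving all the choices (choice of leaf, of $\mathsf{n}'$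 in REDUCE, and of pairs in EXPAND). The tree it constructs is the current tree when it stops. *)

theory Defs
  imports Main "HOL-Library.Multiset" "HOL-Library.FuncSet" "HOL-Library.Sublist"
begin

section \<open>Labeled Petri nets\<close>

text \<open>
  Places and transitions live in different types, so the two sets are disjoint; the domain
  \<open>(P \<times> T) \<union> (T \<times> P)\<close> of the weight function becomes a sum type.
  The fixed total order on places is the one of the type class \<^class>\<open>linorder\<close>.
  Multisets over places are ordered componentwise by \<open>\<subseteq>#\<close>
  (the orders \<open>\<le>\<close> and \<open><\<close> on multisets mean something else and are not used), and
  \<open>-\<close> on multisets is the truncated subtraction.
\<close>

record ('p, 't, 'a) petri_net =
  places :: "'p set"
  transitions :: "'t set"
  weight :: "('p \<times> 't) + ('t \<times> 'p) \<Rightarrow> nat"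
  label :: "'t \<Rightarrow> 'a"

definition labeled_petri_net :: "('p, 't, 'a) petri_net \<Rightarrow> bool" where
  "labeled_petri_net N \<longleftrightarrow> finite (places N) \<and> finite (transitions N)"

definition resources :: "('p, 't, 'a) petri_net \<Rightarrow> 'p multiset set" where
  "resources N = {m. set_mset m \<subseteq> places N}"

definition pre :: "('p, 't, 'a) petri_net \<Rightarrow> 't \<Rightarrow> 'p multiset" where
  "pre N t = (\<Sum>p\<in>places N. replicate_mset (weight N (Inl (p, t))) p)"

definition post :: "('p, 't, 'a) petri_net \<Rightarrow> 't \<Rightarrow> 'p multiset" where
  "post N t = (\<Sum>p\<in>places N. replicate_mset (weight N (Inr (t, p))) p)"

lemma count_pre:
  assumes "labeled_petri_net N"
  shows "count (pre N t) p = (if p \<in> places N then weight N (Inl (p, t)) else 0)"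
  using assms by (simp add: pre_def labeled_petri_net_def count_sum sum.delta)

lemma count_post:
  assumes "labeled_petri_net N"
  shows "count (post N t) p = (if p \<in> places N then weight N (Inr (t, p)) else 0)"
  using assms by (simp add: post_def labeled_petri_net_def count_sum sum.delta)

definition fires :: "('p, 't, 'a) petri_net \<Rightarrow> 'p multiset \<Rightarrow> 't \<Rightarrow> 'p multiset \<Rightarrow> bool" where
  "fires N M t M' \<longleftrightarrow> t \<in> transitions N \<and> pre N t \<subseteq># M \<and> M' = (M - pre N t) + post N t"

section \<open>Resource bisimilarity\<close>

type_synonym 'p rpair = "'p multiset \<times> 'p multiset"

definition resource_transfer ::
  "('p, 't, 'a) petri_net \<Rightarrow> 'p rpair set \<Rightarrow> 'p rpair set \<Rightarrow> bool" where
  "resource_transfer N R R' \<longleftrightarrow>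
     (\<forall>(r, s) \<in> R. \<forall>t \<in> transitions N. \<forall>r'. fires N (r + (pre N t - r)) t r' \<longrightarrow>
        (\<exists>u \<in> transitions N. \<exists>s'. fires N (s + (pre N t - r)) u s' \<and>
           label N u = label N t \<and> (r', s') \<in> R'))"

definition resource_bisimulation :: "('p, 't, 'a) petri_net \<Rightarrow> 'p rpair set \<Rightarrow> bool" where
  "resource_bisimulation N R \<longleftrightarrow> R \<subseteq> resources N \<times> resources N \<and>
     resource_transfer N R R \<and> resource_transfer N (R\<inverse>) (R\<inverse>)"

definition resource_bisimilar ::
  "('p, 't, 'a) petri_net \<Rightarrow> 'p multiset \<Rightarrow> 'p multiset \<Rightarrow> bool" where
  "resource_bisimilar N r s \<longleftrightarrow> (\<exists>R. resource_bisimulation N R \<and> (r, s) \<in> R)"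

definition one_step_relation :: "('p, 't, 'a) petri_net \<Rightarrow> 'p rpair set \<Rightarrow> bool" where
  "one_step_relation N R \<longleftrightarrow> R \<subseteq> resources N \<times> resources N \<and> sym R \<and>
     resource_transfer N R (resources N \<times> resources N)"

text \<open>The relation \<open>\<simeq>\<^sub>1\<close>, obtained as a union; the lemma below it says that it is the largest
  relation of its kind.\<close>

definition bisimilar1 :: "('p, 't, 'a) petri_net \<Rightarrow> 'p rpair set" where
  "bisimilar1 N = \<Union> {R. one_step_relation N R}"

lemma bisimilar1_largest:
  "one_step_relation N (bisimilar1 N)"
  "one_step_relation N R \<Longrightarrow> R \<subseteq> bisimilar1 N"
proof -
  have "sym (bisimilar1 N)"
    unfolding bisimilar1_def one_step_relation_def sym_def by blast
  moreover have "resource_transfer N (bisimilar1 N) (resources N \<times> resources N)"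
    unfolding bisimilar1_def one_step_relation_def resource_transfer_def by blast
  ultimately show "one_step_relation N (bisimilar1 N)"
    unfolding one_step_relation_def by (auto simp: bisimilar1_def one_step_relation_def)
qed (auto simp: bisimilar1_def)

definition next_pairs ::
  "('p, 't, 'a) petri_net \<Rightarrow> 't \<Rightarrow> 'p multiset \<Rightarrow> 'p multiset \<Rightarrow> 'p rpair set" where
  "next_pairs N t r s = {(r', s'). fires N (r + (pre N t - r)) t r' \<and>
     (\<exists>u \<in> transitions N. label N u = label N t \<and> fires N (s + (pre N t - r)) u s')}"

section \<open>Trees labeled with pairs of resources\<close>

text \<open>
  In the trees built by the algorithm different children of a node have different labels, so a node
  is determined by the sequence of labels on the path from the root to it. Nodes are represented by
  these nonempty sequences: the label of a node is its last entry, its ancestors are its nonempty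
  proper prefixes, and its children are its extensions by one entry. A tree is its set of nodes.
\<close>

type_synonym 'p node = "'p rpair list"
type_synonym 'p tree = "'p node set"

abbreviation node_label :: "'p node \<Rightarrow> 'p rpair" where
  "node_label \<equiv> last"

definition resource_tree :: "('p, 't, 'a) petri_net \<Rightarrow> 'p rpair \<Rightarrow> 'p tree \<Rightarrow> bool" where
  "resource_tree N x \<T> \<longleftrightarrow> [x] \<in> \<T> \<and>
     (\<forall>n \<in> \<T>. n \<noteq> [] \<and> hd n = x \<and> node_label n \<in> resources N \<times> resources N \<and>
        (\<forall>n'. n' \<noteq> [] \<and> prefix n' n \<longrightarrow> n' \<in> \<T>))"

definition leaves :: "'p tree \<Rightarrow> 'p node set" where
  "leaves \<T> = {n \<in> \<T>. \<forall>x. n @ [x] \<notin> \<T>}"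

definition identity_node :: "'p node \<Rightarrow> bool" where
  "identity_node n \<longleftrightarrow> (\<exists>r. node_label n = (r, r))"

definition unsuccessful_leaf :: "('p, 't, 'a) petri_net \<Rightarrow> 'p node \<Rightarrow> bool" where
  "unsuccessful_leaf N n \<longleftrightarrow> node_label n \<notin> bisimilar1 N"

definition successful :: "'p tree \<Rightarrow> bool" where
  "successful \<T> \<longleftrightarrow> (\<forall>n \<in> leaves \<T>. identity_node n)"

section \<open>The algorithm\<close>

definition lex_less :: "'p::linorder multiset \<Rightarrow> 'p multiset \<Rightarrow> bool" where
  "lex_less m m' \<longleftrightarrow> (\<exists>p. count m p < count m' p \<and> (\<forall>q < p. count m q = count m' q))"

definition smaller :: "'p::linorder multiset \<Rightarrow> 'p multiset \<Rightarrow> bool" where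
  "smaller m m' \<longleftrightarrow> size m < size m' \<or> size m = size m' \<and> lex_less m m'"

definition reducers :: "'p node \<Rightarrow> 'p node set" where
  "reducers n = {n'. n' \<noteq> [] \<and> strict_prefix n' n \<and>
     fst (node_label n') \<subseteq># fst (node_label n) \<and> snd (node_label n') \<subseteq># snd (node_label n)}"

datatype answer = YES | NO

datatype 'p config = Running "'p tree" | Stopped "'p tree" answer

text \<open>A move records all choices made in one step: the leaf, for a reduction also the selected
  ancestor, and for an expansion also the pairs selected for each transition.\<close>

datatype ('p, 't) move =
    Accept
  | Reduce "'p node" "'p node"
  | Reject "'p node"
  | Expand "'p node" "'t \<Rightarrow> 'p rpair" "'t \<Rightarrow> 'p rpair"

inductive alg_step ::
  "('p::linorder, 't, 'a) petri_net \<Rightarrow> 'p config \<Rightarrow> ('p, 't) move \<Rightarrow> 'p config \<Rightarrow> bool"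
  for N where
  accept: "successful \<T> \<Longrightarrow> alg_step N (Running \<T>) Accept (Stopped \<T> YES)"
| reduce_right:
    "\<lbrakk>n \<in> leaves \<T>; node_label n = (r, s); r \<noteq> s;
      n' \<in> reducers n; node_label n' = (r', s'); smaller r' s'\<rbrakk>
     \<Longrightarrow> alg_step N (Running \<T>) (Reduce n n')
          (Running (\<T> \<union> {n @ [(r, (s - s') + r')]}))"
| reduce_left:
    "\<lbrakk>n \<in> leaves \<T>; node_label n = (r, s); r \<noteq> s;
      n' \<in> reducers n; node_label n' = (r', s'); smaller s' r'\<rbrakk>
     \<Longrightarrow> alg_step N (Running \<T>) (Reduce n n')
          (Running (\<T> \<union> {n @ [((r - r') + s', s)]}))"
| reject:
    "\<lbrakk>n \<in> leaves \<T>; node_label n = (r, s); r \<noteq> s; reducers n = {}; (r, s) \<notin> bisimilar1 N\<rbrakk>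
     \<Longrightarrow> alg_step N (Running \<T>) (Reject n) (Stopped \<T> NO)"
| expand:
    "\<lbrakk>n \<in> leaves \<T>; node_label n = (r, s); r \<noteq> s; reducers n = {}; (r, s) \<in> bisimilar1 N;
      f \<in> (\<Pi>\<^sub>E t\<in>transitions N. next_pairs N t r s);
      g \<in> (\<Pi>\<^sub>E t\<in>transitions N. next_pairs N t s r)\<rbrakk>
     \<Longrightarrow> alg_step N (Running \<T>) (Expand n f g)
          (Running (\<T> \<union> {n @ [x] | x. x \<in> f ` transitions N \<union> g ` transitions N}))"

text \<open>
  A computation is a maximal, finite or infinite, sequence of steps from the initial configuration.
  It is represented by an infinite sequence of configurations, each paired with the move
  made in it. The move is \<^const>\<open>None\<close> only if no step is possible; from there on the sequence is
  constant, so that every maximal sequence of steps has exactly one representation.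
\<close>

type_synonym ('p, 't) computation = "nat \<Rightarrow> 'p config \<times> ('p, 't) move option"

definition computation ::
  "('p::linorder, 't, 'a) petri_net \<Rightarrow> 'p multiset \<Rightarrow> 'p multiset \<Rightarrow> ('p, 't) computation \<Rightarrow> bool" where
  "computation N r\<^sub>0 s\<^sub>0 \<rho> \<longleftrightarrow> fst (\<rho> 0) = Running {[(r\<^sub>0, s\<^sub>0)]} \<and>
     (\<forall>i. case snd (\<rho> i) of
            Some m \<Rightarrow> alg_step N (fst (\<rho> i)) m (fst (\<rho> (Suc i)))
          | None \<Rightarrow> (\<nexists>m c. alg_step N (fst (\<rho> i)) m c) \<and> \<rho> (Suc i) = \<rho> i)"

text \<open>The computation is finite, constructs the tree \<open>\<T>\<close> and returns the answer \<open>a\<close>.\<close>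

definition finishes_with :: "('p, 't) computation \<Rightarrow> 'p tree \<Rightarrow> answer \<Rightarrow> bool" where
  "finishes_with \<rho> \<T> a \<longleftrightarrow> (\<exists>i. \<rho> i = (Stopped \<T> a, None))"

end

theory Submission
  imports Defs "HOL-Library.Infinite_Set"
begin

text \<open>
  Termination: a reduction strictly decreases the label of a node in a transitive relation that is
  incompatible with the componentwise order, and an expanded node dominates none of its ancestors.
  By Dickson's lemma an infinite branch can have neither infinitely many expansions nor a tail of
  reductions only. Since every node has only finitely many possible child labels, all runs together
  create only finitely many nodes.

  Correctness: resource bisimilarity is a congruence, hence a run on bisimilar resources can keep
  all labels bisimilar. Conversely, the congruence generated by the labels of the expanded
  nodes of a successful tree contains all labels of the tree, so these generators form a resource
  bisimulation up to congruence.
\<close>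

section \<open>Bisimulation up to congruence\<close>

text \<open>Runs have no common shape, since leaves are chosen in any order. What unites them is
  that the possible labels of a child depend only on the path to its parent, and in this encoding
  the path is the parent itself. So one set \<open>node_universe N [x]\<close> holds the nodes of
  all runs. It is finite as in Koenig's lemma, by finite branching and the absence of infinite
  branches, and every step that does not stop the run adds a node of it. This bounds the length of
  all runs uniformly.

  The strict decrease under reduction is used twice. A reduction may only be undone inside a
  congruence that already contains the label of the selected ancestor, and this ancestor may itself
  be a reduced node; the decrease rules out a circular justification.\<close>

lemma pre_resources [simp]:
  assumes "labeled_petri_net N"
  shows "pre N t \<in> resources N"
  using assms by (auto simp: resources_def count_pre simp flip: count_greater_zero_iff split: if_splits)

lemma post_resources [simp]:
  assumes "labeled_petri_net N"
  shows "post N t \<in> resources N"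
  using assms by (auto simp: resources_def count_post simp flip: count_greater_zero_iff split: if_splits)

lemma resources_add [simp]:
  "r + s \<in> resources N \<longleftrightarrow> r \<in> resources N \<and> s \<in> resources N"
  by (auto simp: resources_def)

lemma resources_diff [simp]: "r \<in> resources N \<Longrightarrow> r - s \<in> resources N"
  by (auto simp: resources_def dest: in_diffD)

lemma fires_resources:
  assumes "labeled_petri_net N" "fires N M t M'" "M \<in> resources N"
  shows "M' \<in> resources N"
  using assms by (auto simp: fires_def)

lemma fires_add: "fires N M t M' \<Longrightarrow> fires N (M + w) t (M' + w)"
  by (auto simp: fires_def multiset_eq_iff subseteq_mset_def trans_le_add1)

lemma fires_needed: "t \<in> transitions N \<Longrightarrow> \<exists>r'. fires N (r + (pre N t - r)) t r'"
  by (auto simp: fires_def subseteq_mset_def)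

text \<open>The context \<open>w\<close> must supply at least the deficit
  \<open>pre N t - r\<close>; what it holds beyond that takes no part in the firing and is carried
  over unchanged.\<close>

lemma fires_split:
  assumes "fires N (r + w) t r'"
  obtains r1 where "fires N (r + (pre N t - r)) t r1" "r' = r1 + (w - (pre N t - r))"
    "w = (pre N t - r) + (w - (pre N t - r))"
proof -
  have t: "t \<in> transitions N" and sub: "pre N t \<subseteq># r + w"
    and r': "r' = (r + w) - pre N t + post N t"
    using assms by (auto simp: fires_def)
  obtain r1 where r1: "fires N (r + (pre N t - r)) t r1"
    using fires_needed[OF t] by blast
  have w: "w = (pre N t - r) + (w - (pre N t - r))"
    using sub by (simp add: subset_eq_diff_conv union_commute)
  have "fires N (r + w) t (r1 + (w - (pre N t - r)))"
    using fires_add[OF r1, of "w - (pre N t - r)"] w by (simp add: add.assoc)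
  hence "r' = r1 + (w - (pre N t - r))"
    using r' by (simp add: fires_def)
  with r1 w show thesis using that by blast
qed

inductive_set congruence_closure ::
  "('p, 't, 'a) petri_net \<Rightarrow> 'p rpair set \<Rightarrow> 'p rpair set" for N E where
  base: "(r, s) \<in> E \<Longrightarrow> (r, s) \<in> congruence_closure N E"
| reflexive: "r \<in> resources N \<Longrightarrow> (r, r) \<in> congruence_closure N E"
| symmetric: "(r, s) \<in> congruence_closure N E \<Longrightarrow> (s, r) \<in> congruence_closure N E"
| transitive: "(r, s) \<in> congruence_closure N E \<Longrightarrow> (s, q) \<in> congruence_closure N E
    \<Longrightarrow> (r, q) \<in> congruence_closure N E"
| additive: "(r, s) \<in> congruence_closure N E \<Longrightarrow> w \<in> resources N
    \<Longrightarrow> (r + w, s + w) \<in> congruence_closure N E"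

lemma congruence_closure_resources:
  assumes "(r, s) \<in> congruence_closure N E" "E \<subseteq> resources N \<times> resources N"
  shows "r \<in> resources N \<and> s \<in> resources N"
  using assms by (induction) auto

text \<open>Unlike the resource transfer property, this version with an arbitrary context \<open>w\<close> is
  preserved by transitivity.\<close>

definition context_transfer ::
  "('p, 't, 'a) petri_net \<Rightarrow> 'p rpair set \<Rightarrow> 'p multiset \<Rightarrow> 'p multiset \<Rightarrow> bool" where
  "context_transfer N C r s \<longleftrightarrow>
     (\<forall>w \<in> resources N. \<forall>t r'. fires N (r + w) t r' \<longrightarrow>
        (\<exists>u s'. fires N (s + w) u s' \<and> label N u = label N t \<and> (r', s') \<in> C))"

text \<open>The surplus of \<open>w\<close> over the minimal context is added on both sides and
  absorbed by the rule \<open>additive\<close>. \<open>E\<close> and \<open>E'\<close> are separate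
  so that \<open>E\<inverse>\<close> can be treated against the closure of \<open>E\<close>.\<close>

lemma context_transfer_base:
  assumes E: "resource_transfer N E (congruence_closure N E')" "(r, s) \<in> E"
  shows "context_transfer N (congruence_closure N E') r s"
  unfolding context_transfer_def
proof (intro ballI allI impI)
  fix w t r'
  assume w: "w \<in> resources N" and "fires N (r + w) t r'"
  then obtain r1 where r1: "fires N (r + (pre N t - r)) t r1"
    and r': "r' = r1 + (w - (pre N t - r))"
    and weq: "w = (pre N t - r) + (w - (pre N t - r))"
    by (blast elim: fires_split)
  have "t \<in> transitions N"
    using r1 by (auto simp: fires_def)
  then obtain u s1 where s1: "fires N (s + (pre N t - r)) u s1" "label N u = label N t"
    "(r1, s1) \<in> congruence_closure N E'"
    using E r1 unfolding resource_transfer_def by blast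
  have "fires N (s + w) u (s1 + (w - (pre N t - r)))"
    using fires_add[OF s1(1), of "w - (pre N t - r)"] weq by (simp add: add.assoc)
  moreover have "(r', s1 + (w - (pre N t - r))) \<in> congruence_closure N E'"
    unfolding r' using s1(3) w by (intro congruence_closure.additive) auto
  ultimately show "\<exists>u s'. fires N (s + w) u s' \<and> label N u = label N t
      \<and> (r', s') \<in> congruence_closure N E'"
    using s1(2) by blast
qed

text \<open>The answer \<open>u\<close> of the middle resource has its own deficit
  \<open>pre N u - s\<close>, which may differ from \<open>pre N t - r\<close>. With all contexts
  allowed, the same \<open>w\<close> serves both halves.\<close>

lemma context_transfer_trans:
  assumes "context_transfer N (congruence_closure N E) r s"
    "context_transfer N (congruence_closure N E) s q"
  shows "context_transfer N (congruence_closure N E) r q"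
  unfolding context_transfer_def
proof (intro ballI allI impI)
  fix w t r'
  assume w: "w \<in> resources N" and "fires N (r + w) t r'"
  then obtain u s' where s': "fires N (s + w) u s'" "label N u = label N t"
    "(r', s') \<in> congruence_closure N E"
    using assms(1) unfolding context_transfer_def by blast
  then obtain v q' where "fires N (q + w) v q'" "label N v = label N u"
    "(s', q') \<in> congruence_closure N E"
    using assms(2) w unfolding context_transfer_def by blast
  with s' show "\<exists>u s'. fires N (q + w) u s' \<and> label N u = label N t
      \<and> (r', s') \<in> congruence_closure N E"
    by (metis congruence_closure.transitive)
qed

lemma context_transfer_add:
  assumes "context_transfer N C r s" "v \<in> resources N"
  shows "context_transfer N C (r + v) (s + v)"
  using assms unfolding context_transfer_def by (metis add.assoc resources_add)

text \<open>Both directions go through the induction together because the rule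
  \<open>symmetric\<close> exchanges them.\<close>

lemma context_transfer_congruence_closure:
  assumes N: "labeled_petri_net N"
    and E: "resource_transfer N E (congruence_closure N E)"
      "resource_transfer N (E\<inverse>) (congruence_closure N E)"
    and rs: "(r, s) \<in> congruence_closure N E"
  shows "context_transfer N (congruence_closure N E) r s
    \<and> context_transfer N (congruence_closure N E) s r"
  using rs
proof induction
  case (base r s)
  then show ?case using E context_transfer_base by blast
next
  case (reflexive r)
  have "(r', r') \<in> congruence_closure N E"
    if "fires N (r + w) t r'" "w \<in> resources N" for w t r'
    using fires_resources[OF N that(1)] that(2) reflexive by (simp add: congruence_closure.reflexive)
  then have "context_transfer N (congruence_closure N E) r r"
    unfolding context_transfer_def by metis
  then show ?case by simp
next
  case (transitive r s q)
  then show ?case by (meson context_transfer_trans)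
next
  case (additive r s w)
  then show ?case by (meson context_transfer_add)
qed blast

text \<open>The minimal context \<open>pre N t - r\<close> is one of the contexts \<open>w\<close>.
  With bisimilarity as \<open>E\<close> this shows that bisimilarity is a congruence; with the
  labels of the expanded nodes it gives soundness.\<close>

lemma resource_bisimulation_congruence_closure:
  assumes N: "labeled_petri_net N" and E: "E \<subseteq> resources N \<times> resources N"
    and "resource_transfer N E (congruence_closure N E)"
      "resource_transfer N (E\<inverse>) (congruence_closure N E)"
  shows "resource_bisimulation N (congruence_closure N E)"
proof -
  let ?C = "congruence_closure N E"
  have "resource_transfer N ?C ?C"
    unfolding resource_transfer_def
  proof clarify
    fix r s t r'
    assume "(r, s) \<in> ?C" and "fires N (r + (pre N t - r)) t r'"
    moreover have "pre N t - r \<in> resources N"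
      using N by simp
    ultimately show "\<exists>u\<in>transitions N. \<exists>s'. fires N (s + (pre N t - r)) u s'
        \<and> label N u = label N t \<and> (r', s') \<in> ?C"
      using context_transfer_congruence_closure[OF N assms(3,4)]
      unfolding context_transfer_def by (meson fires_def)
  qed
  moreover have "?C\<inverse> = ?C"
    by (auto intro: congruence_closure.symmetric)
  moreover have "?C \<subseteq> resources N \<times> resources N"
    using congruence_closure_resources[OF _ E] by auto
  ultimately show ?thesis
    by (simp add: resource_bisimulation_def)
qed

section \<open>Resource bisimilarity as a congruence, and its children\<close>

definition bisimilarity :: "('p, 't, 'a) petri_net \<Rightarrow> 'p rpair set" where
  "bisimilarity N = {(r, s). resource_bisimilar N r s}"

lemma bisimilarity_bisimulation: "resource_bisimulation N (bisimilarity N)"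
  unfolding resource_bisimulation_def
proof (intro conjI)
  show "bisimilarity N \<subseteq> resources N \<times> resources N"
    by (auto simp: bisimilarity_def resource_bisimilar_def resource_bisimulation_def)
  show "resource_transfer N (bisimilarity N) (bisimilarity N)"
    unfolding bisimilarity_def resource_bisimilar_def resource_bisimulation_def
      resource_transfer_def by blast
  show "resource_transfer N ((bisimilarity N)\<inverse>) ((bisimilarity N)\<inverse>)"
    unfolding bisimilarity_def resource_bisimilar_def resource_bisimulation_def
      resource_transfer_def by blast
qed

lemma resource_transfer_mono:
  "resource_transfer N R R' \<Longrightarrow> R' \<subseteq> S \<Longrightarrow> resource_transfer N R S"
  unfolding resource_transfer_def by blast

text \<open>The closure is a bisimulation, and bisimilarity contains every bisimulation.\<close>

lemma congruence_closure_bisimilarity: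
  assumes "labeled_petri_net N"
  shows "congruence_closure N (bisimilarity N) = bisimilarity N"
proof
  have B: "bisimilarity N \<subseteq> resources N \<times> resources N"
    "resource_transfer N (bisimilarity N) (bisimilarity N)"
    "resource_transfer N ((bisimilarity N)\<inverse>) ((bisimilarity N)\<inverse>)"
    using bisimilarity_bisimulation unfolding resource_bisimulation_def by blast+
  have "resource_bisimulation N (congruence_closure N (bisimilarity N))"
    using assms B(1) by (rule resource_bisimulation_congruence_closure)
      (rule resource_transfer_mono[OF B(2)] resource_transfer_mono[OF B(3)];
        auto intro: congruence_closure.intros)+
  then show "congruence_closure N (bisimilarity N) \<subseteq> bisimilarity N"
    by (auto simp: bisimilarity_def resource_bisimilar_def)
qed (auto intro: congruence_closure.base)

lemma bisimilarity_sym: "(r, s) \<in> bisimilarity N \<Longrightarrow> (s, r) \<in> bisimilarity N"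
proof -
  assume "(r, s) \<in> bisimilarity N"
  then obtain R where "resource_bisimulation N R" "(r, s) \<in> R"
    by (auto simp: bisimilarity_def resource_bisimilar_def)
  then have "resource_bisimulation N (R\<inverse>)" "(s, r) \<in> R\<inverse>"
    by (auto simp: resource_bisimulation_def)
  then show ?thesis
    unfolding bisimilarity_def resource_bisimilar_def by blast
qed

text \<open>Hence a run that keeps all labels bisimilar never rejects.\<close>

lemma bisimilarity_subset_bisimilar1: "bisimilarity N \<subseteq> bisimilar1 N"
proof (rule bisimilar1_largest(2))
  show "one_step_relation N (bisimilarity N)"
    using bisimilarity_bisimulation[of N] bisimilarity_sym[of _ _ N]
    unfolding one_step_relation_def resource_bisimulation_def sym_def
    by (blast intro: resource_transfer_mono)
qed

lemma next_pairs_bisimilarity: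
  assumes "(r, s) \<in> bisimilarity N" "t \<in> transitions N"
  shows "\<exists>x \<in> next_pairs N t r s. x \<in> bisimilarity N"
proof -
  obtain r' where r': "fires N (r + (pre N t - r)) t r'"
    using fires_needed[OF assms(2)] by blast
  then obtain u s' where "u \<in> transitions N" "fires N (s + (pre N t - r)) u s'"
    "label N u = label N t" "(r', s') \<in> bisimilarity N"
    using bisimilarity_bisimulation[of N] assms
    unfolding resource_bisimulation_def resource_transfer_def by blast
  then show ?thesis using r' unfolding next_pairs_def by blast
qed

text \<open>So an expansion that is not rejected always has pairs to select.\<close>

lemma next_pairs_bisimilar1:
  assumes "(r, s) \<in> bisimilar1 N" "t \<in> transitions N"
  shows "next_pairs N t r s \<noteq> {}"
proof -
  obtain r' where r': "fires N (r + (pre N t - r)) t r'"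
    using fires_needed[OF assms(2)] by blast
  then show ?thesis
    using bisimilar1_largest(1)[of N] assms
    unfolding one_step_relation_def resource_transfer_def next_pairs_def by blast
qed

lemma bisimilar1_sym: "(r, s) \<in> bisimilar1 N \<Longrightarrow> (s, r) \<in> bisimilar1 N"
  using bisimilar1_largest(1)[of N] by (auto simp: one_step_relation_def dest: symD)

lemma bisimilar1_refl:
  assumes "labeled_petri_net N" "r \<in> resources N"
  shows "(r, r) \<in> bisimilar1 N"
proof -
  have "(r, r) \<in> bisimilarity N"
    using congruence_closure.reflexive[OF assms(2)] congruence_closure_bisimilarity[OF assms(1)] by blast
  then show ?thesis using bisimilarity_subset_bisimilar1 by blast
qed

lemma next_pairs_resources:
  assumes "labeled_petri_net N" "r \<in> resources N" "s \<in> resources N"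
  shows "next_pairs N t r s \<subseteq> resources N \<times> resources N"
  using assms by (auto simp: next_pairs_def fires_def)

text \<open>Firing is deterministic, so for fixed \<open>t\<close> a pair is determined by the
  answering transition \<open>u\<close>.\<close>

lemma finite_next_pairs:
  assumes "labeled_petri_net N"
  shows "finite (next_pairs N t r s)"
proof (rule finite_subset)
  show "next_pairs N t r s \<subseteq> (\<lambda>u. (r + (pre N t - r) - pre N t + post N t,
      s + (pre N t - r) - pre N u + post N u)) ` transitions N"
    by (auto simp: next_pairs_def fires_def)
qed (use assms in \<open>simp add: labeled_petri_net_def\<close>)

section \<open>Dickson's lemma and the order on resources\<close>

text \<open>An index \<open>k\<close> at which \<open>x\<close> takes its least value beyond
  \<open>m\<close> satisfies \<open>x k \<le> x j\<close> for all \<open>j \<ge> k\<close>. Such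
  indices, chosen one after the other, form the subsequence.\<close>

lemma nondecreasing_subsequence:
  fixes x :: "nat \<Rightarrow> nat"
  shows "\<exists>\<phi> :: nat \<Rightarrow> nat. strict_mono \<phi> \<and> mono (x \<circ> \<phi>)"
proof -
  have ex: "\<exists>k > m. \<forall>j \<ge> k. x k \<le> x j" for m
  proof -
    obtain k where "k > m" "\<forall>j. j > m \<longrightarrow> x k \<le> x j"
      using ex_has_least_nat[of "\<lambda>k. k > m" "Suc m" x] by auto
    then show ?thesis by (meson order_less_le_trans)
  qed
  have "\<exists>\<phi>. \<forall>n. (\<forall>j \<ge> \<phi> n. x (\<phi> n) \<le> x j) \<and> \<phi> n < \<phi> (Suc n)"
    by (rule dependent_nat_choice) (use ex in blast)+
  then obtain \<phi> where \<phi>: "\<And>n. \<forall>j \<ge> \<phi> n. x (\<phi> n) \<le> x j" "\<And>n. \<phi> n < \<phi> (Suc n)"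
    by blast
  then have "strict_mono \<phi>" "mono (x \<circ> \<phi>)"
    by (auto simp: strict_mono_Suc_iff mono_iff_le_Suc less_imp_le)
  then show ?thesis by blast
qed

text \<open>A whole monotone subsequence is produced because it can be thinned out again for the
  next coordinate, which a single comparable pair cannot.\<close>

lemma dickson:
  fixes f :: "nat \<Rightarrow> 'c \<Rightarrow> nat"
  assumes "finite C"
  shows "\<exists>\<phi> :: nat \<Rightarrow> nat. strict_mono \<phi> \<and> (\<forall>c \<in> C. mono (\<lambda>i. f (\<phi> i) c))"
  using assms
proof induction
  case empty
  have "strict_mono (\<lambda>i :: nat. i)" by (simp add: strict_mono_def)
  then show ?case by blast
next
  case (insert c C)
  then obtain \<phi> :: "nat \<Rightarrow> nat" where \<phi>: "strict_mono \<phi>" "\<forall>c \<in> C. mono (\<lambda>i. f (\<phi> i) c)"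
    by blast
  obtain \<psi> :: "nat \<Rightarrow> nat" where \<psi>: "strict_mono \<psi>" "mono ((\<lambda>i. f (\<phi> i) c) \<circ> \<psi>)"
    using nondecreasing_subsequence by blast
  have "mono (\<lambda>i. f ((\<phi> \<circ> \<psi>) i) d)" if "d \<in> C" for d
    using \<phi>(2) that strict_mono_mono[OF \<psi>(1)] by (auto simp: mono_def)
  moreover have "mono (\<lambda>i. f ((\<phi> \<circ> \<psi>) i) c)"
    using \<psi>(2) by (simp add: comp_def)
  moreover have "strict_mono (\<phi> \<circ> \<psi>)"
    using \<phi>(1) \<psi>(1) by (simp add: strict_mono_def)
  ultimately show ?case by blast
qed

definition pair_le :: "'p rpair \<Rightarrow> 'p rpair \<Rightarrow> bool" where
  "pair_le y x \<longleftrightarrow> fst y \<subseteq># fst x \<and> snd y \<subseteq># snd x"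

lemma dickson_pairs:
  fixes y :: "nat \<Rightarrow> 'p rpair"
  assumes "labeled_petri_net N" "\<And>i. y i \<in> resources N \<times> resources N"
  shows "\<exists>i j. i < j \<and> pair_le (y i) (y j)"
proof -
  \<comment> \<open>A pair of resources is read as one vector over two copies of the places.\<close>
  define f where "f i c = (case c of Inl p \<Rightarrow> count (fst (y i)) p | Inr p \<Rightarrow> count (snd (y i)) p)"
    for i and c :: "'p + 'p"
  obtain \<phi> :: "nat \<Rightarrow> nat" where \<phi>: "strict_mono \<phi>" "\<forall>c \<in> places N <+> places N. mono (\<lambda>i. f (\<phi> i) c)"
    using dickson[of "places N <+> places N" f] assms(1) by (auto simp: labeled_petri_net_def)
  have le: "f (\<phi> 0) c \<le> f (\<phi> 1) c" if "c \<in> places N <+> places N" for c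
    using \<phi>(2) that by (auto simp: mono_def)
  have zero: "count (fst (y i)) p = 0" "count (snd (y i)) p = 0" if "p \<notin> places N" for i p
    using assms(2)[of i] that by (auto simp: resources_def not_in_iff[symmetric])
  have "count (fst (y (\<phi> 0))) p \<le> count (fst (y (\<phi> 1))) p" for p
    using le[of "Inl p"] zero(1)[of p] by (cases "p \<in> places N") (auto simp: f_def)
  moreover have "count (snd (y (\<phi> 0))) p \<le> count (snd (y (\<phi> 1))) p" for p
    using le[of "Inr p"] zero(2)[of p] by (cases "p \<in> places N") (auto simp: f_def)
  moreover have "\<phi> 0 < \<phi> 1"
    using \<phi>(1) by (simp add: strict_mono_def)
  ultimately show ?thesis
    by (auto simp: pair_le_def subseteq_mset_def)
qed

section \<open>Ordering resources by size, then lexicographically; effect of a reduction\<close>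

lemma smaller_irrefl: "\<not> smaller m m"
  by (simp add: smaller_def lex_less_def)

lemma lex_less_trans:
  assumes "lex_less a b" "lex_less b c"
  shows "lex_less a c"
proof -
  obtain p where p: "count a p < count b p" "\<forall>q < p. count a q = count b q"
    using assms(1) by (auto simp: lex_less_def)
  obtain p' where p': "count b p' < count c p'" "\<forall>q < p'. count b q = count c q"
    using assms(2) by (auto simp: lex_less_def)
  consider "p < p'" | "p = p'" | "p' < p" by fastforce
  then have "count a (min p p') < count c (min p p')"
    using p p' by cases (auto simp: min_def)
  moreover have "\<forall>q < min p p'. count a q = count c q"
    using p p' by auto
  ultimately show ?thesis unfolding lex_less_def by blast
qed

lemma smaller_trans: "smaller a b \<Longrightarrow> smaller b c \<Longrightarrow> smaller a c"
  unfolding smaller_def using lex_less_trans by auto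

lemma smaller_asym: "smaller a b \<Longrightarrow> \<not> smaller b a"
  using smaller_trans smaller_irrefl by blast

text \<open>The multisets are finite, so they differ at finitely many places only, and a least such
  place exists in any linear order.\<close>

lemma lex_less_total:
  assumes "a \<noteq> b"
  shows "lex_less a b \<or> lex_less b a"
proof -
  define D where "D = {p. count a p \<noteq> count b p}"
  have "D \<subseteq> set_mset a \<union> set_mset b"
    by (auto simp: D_def) (metis not_in_iff)
  then have D: "finite D" by (rule finite_subset) simp
  moreover have "D \<noteq> {}"
    using assms by (auto simp: D_def multiset_eq_iff)
  ultimately have "Min D \<in> D" by simp
  moreover have "\<forall>q < Min D. count a q = count b q"
    using Min_le[OF D] unfolding D_def by (metis (mono_tags, lifting) mem_Collect_eq leD)
  ultimately show ?thesis
    unfolding lex_less_def D_def by (metis (mono_tags, lifting) mem_Collect_eq nat_neq_iff)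
qed

lemma smaller_total: "a \<noteq> b \<Longrightarrow> smaller a b \<or> smaller b a"
  unfolding smaller_def using lex_less_total[of a b] by (auto simp: neq_iff)

lemma smaller_add: "smaller a b \<Longrightarrow> smaller (c + a) (c + b)"
  by (auto simp: smaller_def lex_less_def)

text \<open>A proper sub-multiset has smaller size, whereas \<open>smaller a b\<close> implies
  \<open>size a \<le> size b\<close>.\<close>

lemma not_smaller_superset: "b \<subseteq># a \<Longrightarrow> \<not> smaller a b"
  by (metis mset_subset_size smaller_irrefl smaller_def subset_mset.le_imp_less_or_eq
      less_asym less_irrefl)

text \<open>Reflexive closures appear because a reduction changes one component and keeps the other,
  and successive reductions may change different ones.\<close>

definition decreases :: "'p::linorder rpair \<Rightarrow> 'p rpair \<Rightarrow> bool" where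
  "decreases x y \<longleftrightarrow> x \<noteq> y \<and> smaller\<^sup>=\<^sup>= (fst x) (fst y) \<and> smaller\<^sup>=\<^sup>= (snd x) (snd y)"

lemma decreases_trans: "decreases x y \<Longrightarrow> decreases y z \<Longrightarrow> decreases x z"
  unfolding decreases_def
  by (cases x; cases y; cases z) (auto dest: smaller_trans smaller_asym)

text \<open>Domination leaves only equality in each component, which \<open>x \<noteq> y\<close>
  forbids.\<close>

lemma decreases_not_pair_le: "decreases x y \<Longrightarrow> \<not> pair_le y x"
  unfolding decreases_def pair_le_def
  by (cases x; cases y) (auto dest: not_smaller_superset)

text \<open>The reduced label comes first, the label of the selected ancestor second. If the
  components of a dominated \<open>y'\<close> coincide, the \<open>else\<close> branch returns
  \<open>y\<close> itself; hence the later side conditions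
  \<open>fst y' \<noteq> snd y'\<close>.\<close>

definition reduction :: "'p::linorder rpair \<Rightarrow> 'p rpair \<Rightarrow> 'p rpair" where
  "reduction y y' =
     (if smaller (fst y') (snd y') then (fst y, (snd y - snd y') + fst y')
      else ((fst y - fst y') + snd y', snd y))"

text \<open>The part of \<open>y\<close> that is exchanged is the larger component of
  \<open>y'\<close>, and \<open>smaller\<close> is invariant under adding the rest.\<close>

lemma reduction_decreases:
  assumes "pair_le y' y" "fst y' \<noteq> snd y'"
  shows "decreases (reduction y y') y"
proof (cases "smaller (fst y') (snd y')")
  case True
  have "snd y = (snd y - snd y') + snd y'"
    using assms(1) by (simp add: pair_le_def)
  with True have "smaller ((snd y - snd y') + fst y') (snd y)"
    using smaller_add by metis
  with True show ?thesis
    by (cases y) (auto simp: decreases_def reduction_def smaller_irrefl)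
next
  case False
  then have "smaller (snd y') (fst y')"
    using assms(2) smaller_total by blast
  moreover have "fst y = (fst y - fst y') + fst y'"
    using assms(1) by (simp add: pair_le_def)
  ultimately have "smaller ((fst y - fst y') + snd y') (fst y)"
    using smaller_add by metis
  with False show ?thesis
    by (cases y) (auto simp: decreases_def reduction_def smaller_irrefl)
qed

lemma reduction_resources:
  "y \<in> resources N \<times> resources N \<Longrightarrow> y' \<in> resources N \<times> resources N
    \<Longrightarrow> reduction y y' \<in> resources N \<times> resources N"
  by (auto simp: reduction_def)

text \<open>Adding a rest to \<open>y'\<close> shows that the exchanged component is congruent to
  its replacement. From right to left this keeps the labels of a good run bisimilar; from left to
  right it lifts membership from a child to its parent.\<close>

lemma reduction_congruence:
  assumes y': "y' \<in> congruence_closure N E" and le: "pair_le y' y"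
    and y: "y \<in> resources N \<times> resources N"
  shows "reduction y y' \<in> congruence_closure N E \<longleftrightarrow> y \<in> congruence_closure N E"
proof -
  obtain r s r' s' where eq: "y = (r, s)" "y' = (r', s')"
    by (cases y; cases y')
  have r: "r' + (r - r') = r" and s: "s' + (s - s') = s"
    using le by (auto simp: pair_le_def eq)
  have rr: "(r, (r - r') + s') \<in> congruence_closure N E"
    using congruence_closure.additive[of r' s' N E "r - r'"] y' y r
    by (auto simp: eq add.commute)
  have ss: "((s - s') + r', s) \<in> congruence_closure N E"
    using congruence_closure.additive[of r' s' N E "s - s'"] y' y s
    by (auto simp: eq add.commute)
  show ?thesis
    unfolding reduction_def eq using rr ss
    by (auto intro: congruence_closure.transitive congruence_closure.symmetric)
qed

section \<open>The nodes that the algorithm can create\<close>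

text \<open>The tree does not occur: \<open>reducers\<close> only inspects prefixes of the node. The
  relation over-approximates the algorithm, as it omits the test for
  \<open>bisimilar1\<close>.\<close>

definition child_label :: "('p::linorder, 't, 'a) petri_net \<Rightarrow> 'p node \<Rightarrow> 'p rpair \<Rightarrow> bool" where
  "child_label N n x \<longleftrightarrow> (case last n of (r, s) \<Rightarrow> r \<noteq> s \<and>
     ((reducers n = {} \<and> (\<exists>t \<in> transitions N. x \<in> next_pairs N t r s \<union> next_pairs N t s r)) \<or>
      (\<exists>n' \<in> reducers n. fst (last n') \<noteq> snd (last n') \<and> x = reduction (r, s) (last n'))))"

text \<open>The start is an arbitrary node, so that finiteness can be proved by induction towards
  the leaves.\<close>

inductive_set node_universe :: "('p::linorder, 't, 'a) petri_net \<Rightarrow> 'p node \<Rightarrow> 'p node set"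
  for N n where
  root: "n \<in> node_universe N n"
| child: "m \<in> node_universe N n \<Longrightarrow> child_label N m x \<Longrightarrow> m @ [x] \<in> node_universe N n"

definition resource_node :: "('p, 't, 'a) petri_net \<Rightarrow> 'p node \<Rightarrow> bool" where
  "resource_node N n \<longleftrightarrow> n \<noteq> [] \<and> set n \<subseteq> resources N \<times> resources N"

lemma resource_node_last: "resource_node N n \<Longrightarrow> last n \<in> resources N \<times> resources N"
  unfolding resource_node_def using last_in_set by blast

lemma reducersD:
  assumes "n' \<in> reducers n"
  shows "n' \<noteq> []" "strict_prefix n' n" "pair_le (last n') (last n)"
  using assms by (auto simp: reducers_def pair_le_def)

lemma resource_node_reducers:
  "resource_node N n \<Longrightarrow> n' \<in> reducers n \<Longrightarrow> resource_node N n'"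
  using reducersD[of n' n] by (auto simp: resource_node_def strict_prefix_def dest: set_mono_prefix)

lemma child_label_resource_node:
  assumes N: "labeled_petri_net N" and n: "resource_node N n" and x: "child_label N n x"
  shows "resource_node N (n @ [x])"
proof -
  obtain r s where rs: "last n = (r, s)" by force
  have res: "r \<in> resources N" "s \<in> resources N"
    using resource_node_last[OF n] rs by auto
  have "x \<in> resources N \<times> resources N"
  proof (cases "reducers n = {}")
    case True
    then obtain t where "x \<in> next_pairs N t r s \<union> next_pairs N t s r"
      using x unfolding child_label_def rs by auto
    then show ?thesis
      using next_pairs_resources[OF N res] next_pairs_resources[OF N res(2,1)] by blast
  next
    case False
    then obtain n' where n': "n' \<in> reducers n" "x = reduction (r, s) (last n')"
      using x unfolding child_label_def rs by auto
    then show ?thesis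
      using reduction_resources resource_node_last resource_node_reducers[OF n] res
      by (metis mem_Sigma_iff)
  qed
  then show ?thesis
    using n by (auto simp: resource_node_def)
qed

lemma finite_reducers: "finite (reducers n)"
  by (rule finite_subset[of _ "set (prefixes n)"]) (auto simp: reducers_def strict_prefix_def)

lemma finite_child_labels:
  assumes "labeled_petri_net N"
  shows "finite {x. child_label N n x}"
proof -
  obtain r s where rs: "last n = (r, s)" by force
  have "{x. child_label N n x} \<subseteq>
      (\<Union>t \<in> transitions N. next_pairs N t r s \<union> next_pairs N t s r)
      \<union> (\<lambda>n'. reduction (r, s) (last n')) ` reducers n"
    unfolding child_label_def rs by auto
  then show ?thesis
    by (rule finite_subset)
      (use assms in \<open>auto simp: finite_next_pairs finite_reducers labeled_petri_net_def\<close>)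
qed

text \<open>An infinite descending chain is an infinite branch. Dickson's lemma is applied to its
  expanded nodes if there are infinitely many, and otherwise to a tail without any.\<close>

lemma wf_child_label:
  assumes N: "labeled_petri_net N"
  shows "wf {(n @ [x], n) | n x. resource_node N n \<and> child_label N n x}"
  unfolding wf_iff_no_infinite_down_chain
proof
  assume "\<exists>h. \<forall>i. (h (Suc i), h i) \<in> {(n @ [x], n) | n x. resource_node N n \<and> child_label N n x}"
  then obtain h where h: "\<And>i. resource_node N (h i)"
    "\<And>i. \<exists>x. h (Suc i) = h i @ [x] \<and> child_label N (h i) x"
    by blast
  define y where "y i = last (h i)" for i
  have y: "h (Suc i) = h i @ [y (Suc i)]" "child_label N (h i) (y (Suc i))" for i
    using h(2)[of i] by (auto simp: y_def)
  have res: "y i \<in> resources N \<times> resources N" for i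
    using h(1) resource_node_last unfolding y_def by blast
  have prefix: "strict_prefix (h i) (h j)" if "i < j" for i j
    using that
  proof (induction rule: less_Suc_induct)
    case (1 i)
    then show ?case by (simp add: y(1) strict_prefix_def)
  qed (rule prefix_order.less_trans)
  \<comment> \<open>On a branch every earlier node is an ancestor, so domination of the labels
    suffices.\<close>
  have reducer: "h i \<in> reducers (h j)" if "i < j" "pair_le (y i) (y j)" for i j
    using that prefix[of i j] h(1)[of i]
    by (auto simp: reducers_def pair_le_def y_def resource_node_def)
  show False
  proof (cases "infinite {i. reducers (h i) = {}}")
    case True
    then obtain \<phi> :: "nat \<Rightarrow> nat" where \<phi>: "strict_mono \<phi>" "\<And>i. reducers (h (\<phi> i)) = {}"
      using infinite_enumerate[OF True] by auto
    obtain i j where "i < j" "pair_le (y (\<phi> i)) (y (\<phi> j))"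
      using dickson_pairs[OF N, of "y \<circ> \<phi>"] res by auto
    then show False
      using reducer[of "\<phi> i" "\<phi> j"] \<phi> by (auto simp: strict_mono_def)
  next
    case False
    then obtain k where k: "\<And>i. i \<ge> k \<Longrightarrow> reducers (h i) \<noteq> {}"
      using finite_nat_set_iff_bounded by (metis (mono_tags, lifting) leD mem_Collect_eq)
    have dec1: "decreases (y (Suc i)) (y i)" if i: "i \<ge> k" for i
    proof -
      obtain n' where "n' \<in> reducers (h i)" "fst (last n') \<noteq> snd (last n')"
        "y (Suc i) = reduction (y i) (last n')"
        using y(2)[of i] k[OF i] unfolding child_label_def
        by (auto simp: y_def split: prod.splits)
      then show ?thesis
        using reduction_decreases reducersD(3) by (metis y_def)
    qed
    have dec: "decreases (y (k + j)) (y (k + i))" if "i < j" for i j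
      using that
    proof (induction rule: less_Suc_induct)
      case (1 i)
      then show ?case using dec1[of "k + i"] by simp
    qed (blast intro: decreases_trans)
    obtain i j where "i < j" "pair_le (y (k + i)) (y (k + j))"
      using dickson_pairs[OF N, of "\<lambda>i. y (k + i)"] res by auto
    then show False
      using dec decreases_not_pair_le by blast
  qed
qed

text \<open>The inductive set grows at the far end of a path; the well-founded induction needs the
  first step split off instead.\<close>

lemma node_universe_unfold:
  "node_universe N n \<subseteq> insert n (\<Union>x \<in> {x. child_label N n x}. node_universe N (n @ [x]))"
proof
  fix m assume "m \<in> node_universe N n"
  then show "m \<in> insert n (\<Union>x \<in> {x. child_label N n x}. node_universe N (n @ [x]))"
  proof induction
    case (child m x)
    then consider "m = n" | y where "child_label N n y" "m \<in> node_universe N (n @ [y])"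
      by blast
    then show ?case
    proof cases
      case 1
      then show ?thesis using child(2) by (blast intro: node_universe.root)
    next
      case 2
      then show ?thesis using child(2) by (blast intro: node_universe.child)
    qed
  qed simp
qed

lemma finite_node_universe:
  assumes N: "labeled_petri_net N" and "resource_node N n"
  shows "finite (node_universe N n)"
  using wf_child_label[OF N] assms(2)
proof (induction n rule: wf_induct_rule)
  case (less n)
  have "finite (node_universe N (n @ [x]))" if "child_label N n x" for x
    using less that child_label_resource_node[OF N] by blast
  then have "finite (insert n (\<Union>x \<in> {x. child_label N n x}. node_universe N (n @ [x])))"
    using finite_child_labels[OF N] by auto
  then show ?case
    using node_universe_unfold finite_subset by blast
qed

lemma node_universe_resource_node:
  assumes "labeled_petri_net N" "m \<in> node_universe N n" "resource_node N n"
  shows "resource_node N m"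
  using assms(2,3) by induction (use assms(1) child_label_resource_node in blast)+

section \<open>Runs of the algorithm\<close>

lemma node_universe_singleton:
  assumes "m \<in> node_universe N [x]"
  shows "m \<noteq> [] \<and> hd m = x"
  using assms by induction auto

text \<open>Since \<open>child_label\<close> requires distinct components, this shows that no inner
  node, and so no reducer, is an identity-node.\<close>

lemma node_universe_child_label:
  assumes "m @ [y] \<in> node_universe N [x]" "m \<noteq> []"
  shows "child_label N m y"
  using assms by (cases rule: node_universe.cases) auto

text \<open>This and \<open>reduced\<close> only demand that suitable children exist, so they
  persist while the tree grows elsewhere.\<close>

definition expanded :: "('p, 't, 'a) petri_net \<Rightarrow> 'p tree \<Rightarrow> 'p node \<Rightarrow> bool" where
  "expanded N \<T> n \<longleftrightarrow> (case last n of (r, s) \<Rightarrow> \<forall>t \<in> transitions N.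
     (\<exists>y \<in> next_pairs N t r s. n @ [y] \<in> \<T>) \<and> (\<exists>y \<in> next_pairs N t s r. n @ [y] \<in> \<T>))"

definition reduced :: "'p::linorder tree \<Rightarrow> 'p node \<Rightarrow> bool" where
  "reduced \<T> n \<longleftrightarrow> (\<exists>n' \<in> reducers n. n @ [reduction (last n) (last n')] \<in> \<T>)"

lemma expanded_mono: "expanded N \<T> n \<Longrightarrow> \<T> \<subseteq> \<T>' \<Longrightarrow> expanded N \<T>' n"
  unfolding expanded_def by (auto split: prod.splits) (meson subsetD)+

lemma reduced_mono: "reduced \<T> n \<Longrightarrow> \<T> \<subseteq> \<T>' \<Longrightarrow> reduced \<T>' n"
  unfolding reduced_def by blast

text \<open>The order in which the run visited the leaves is forgotten; soundness is proved from
  this invariant alone.\<close>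

definition alg_tree :: "('p::linorder, 't, 'a) petri_net \<Rightarrow> 'p rpair \<Rightarrow> 'p tree \<Rightarrow> bool" where
  "alg_tree N x \<T> \<longleftrightarrow> [x] \<in> \<T> \<and> \<T> \<subseteq> node_universe N [x] \<and>
     (\<forall>n \<in> \<T>. \<forall>n'. n' \<noteq> [] \<and> prefix n' n \<longrightarrow> n' \<in> \<T>) \<and>
     (\<forall>n \<in> \<T>. n \<in> leaves \<T> \<or> expanded N \<T> n \<or> reduced \<T> n)"

lemma alg_treeD:
  assumes "alg_tree N x \<T>"
  shows "[x] \<in> \<T>" "\<T> \<subseteq> node_universe N [x]"
    "n \<in> \<T> \<Longrightarrow> n' \<noteq> [] \<Longrightarrow> prefix n' n \<Longrightarrow> n' \<in> \<T>"
    "n \<in> \<T> \<Longrightarrow> n \<in> leaves \<T> \<or> expanded N \<T> n \<or> reduced \<T> n"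
  using assms unfolding alg_tree_def by blast+

lemma alg_tree_singleton: "alg_tree N x {[x]}"
proof -
  have "n' = [x]" if "n' \<noteq> []" "prefix n' [x]" for n'
    using that by (cases n') auto
  then show ?thesis
    by (auto simp: alg_tree_def leaves_def intro: node_universe.root)
qed

lemma alg_tree_resource_node:
  assumes "labeled_petri_net N" "x \<in> resources N \<times> resources N" "alg_tree N x \<T>" "n \<in> \<T>"
  shows "resource_node N n"
  using node_universe_resource_node[OF assms(1), of n "[x]"] alg_treeD(2)[OF assms(3)] assms(2,4)
  by (auto simp: resource_node_def)

lemma alg_tree_resource_tree:
  assumes "labeled_petri_net N" "x \<in> resources N \<times> resources N" "alg_tree N x \<T>"
  shows "resource_tree N x \<T>"
  unfolding resource_tree_def
  using alg_treeD(1-3)[OF assms(3)] alg_tree_resource_node[OF assms] resource_node_last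
    node_universe_singleton by blast

text \<open>Common core of REDUCE and EXPAND. That \<open>X\<close> is nonempty makes the tree grow
  strictly; for EXPAND this is where the existence of a transition enters.\<close>

lemma alg_tree_extend:
  assumes \<T>: "alg_tree N x \<T>" and n: "n \<in> leaves \<T>" and X: "X \<noteq> {}" "\<forall>y \<in> X. child_label N n y"
    and "\<T>' = \<T> \<union> {n @ [y] | y. y \<in> X}" and new: "expanded N \<T>' n \<or> reduced \<T>' n"
  shows "alg_tree N x \<T>'" "\<T> \<subset> \<T>'"
proof -
  have \<T>': "m \<in> \<T>' \<longleftrightarrow> m \<in> \<T> \<or> (\<exists>y \<in> X. m = n @ [y])" for m
    using assms(5) by blast
  have n1: "n \<in> \<T>" "\<And>y. n @ [y] \<notin> \<T>"
    using n by (auto simp: leaves_def)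
  have old: "m \<in> leaves \<T>' \<or> expanded N \<T>' m \<or> reduced \<T>' m" if m: "m \<in> \<T>" for m
  proof (cases "m = n")
    case False
    have sub: "\<T> \<subseteq> \<T>'" using \<T>' by blast
    have "m \<in> leaves \<T>'" if "m \<in> leaves \<T>"
      using that False \<T>' by (auto simp: leaves_def)
    then show ?thesis
      using alg_treeD(4)[OF \<T> m] expanded_mono[OF _ sub] reduced_mono[OF _ sub] by blast
  qed (use new in blast)
  \<comment> \<open>The old tree is closed under prefixes and contains no child of \<open>n\<close>,
    so the new nodes are leaves.\<close>
  have "n @ [y, z] \<notin> \<T>" for y z
    using alg_treeD(3)[OF \<T>, of "n @ [y, z]" "n @ [y]"] n1 by auto
  then have "n @ [y] \<in> leaves \<T>'" if "y \<in> X" for y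
    using that \<T>' by (auto simp: leaves_def)
  then have "\<forall>m \<in> \<T>'. m \<in> leaves \<T>' \<or> expanded N \<T>' m \<or> reduced \<T>' m"
    using old \<T>' by blast
  moreover have "\<T>' \<subseteq> node_universe N [x]"
    using \<T>' X alg_treeD(2)[OF \<T>] n1(1) by (auto intro: node_universe.child)
  moreover have "n' \<in> \<T>'" if "m \<in> \<T>'" "n' \<noteq> []" "prefix n' m" for n' m
    using that \<T>' alg_treeD(3)[OF \<T>] n1(1) by (auto simp: prefix_snoc)
  ultimately show "alg_tree N x \<T>'"
    unfolding alg_tree_def using \<T>' alg_treeD(1)[OF \<T>] by blast
  show "\<T> \<subset> \<T>'"
    using \<T>' X(1) n1 by blast
qed

lemma reduction_right: "smaller r' s' \<Longrightarrow> reduction (r, s) (r', s') = (r, (s - s') + r')"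
  by (simp add: reduction_def)

lemma reduction_left: "smaller s' r' \<Longrightarrow> reduction (r, s) (r', s') = ((r - r') + s', s)"
  by (simp add: reduction_def smaller_asym)

lemma alg_tree_reduce:
  assumes \<T>: "alg_tree N x \<T>" and n: "n \<in> leaves \<T>" "fst (last n) \<noteq> snd (last n)"
    and n': "n' \<in> reducers n" "fst (last n') \<noteq> snd (last n')"
    and \<T>': "\<T>' = \<T> \<union> {n @ [reduction (last n) (last n')]}"
  shows "alg_tree N x \<T>' \<and> \<T> \<subset> \<T>'"
proof -
  let ?X = "{reduction (last n) (last n')}"
  have X: "?X \<noteq> {}" "\<forall>y \<in> ?X. child_label N n y"
    using n n' by (auto simp: child_label_def split: prod.splits)
  have \<T>'X: "\<T>' = \<T> \<union> {n @ [y] | y. y \<in> ?X}"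
    by (simp only: \<T>' singleton_iff) blast
  have "reduced \<T>' n"
    using n' \<T>' by (auto simp: reduced_def)
  then show ?thesis
    using alg_tree_extend[OF \<T> n(1) X \<T>'X] by simp
qed

lemma alg_tree_expand:
  assumes \<T>: "alg_tree N x \<T>" and n: "n \<in> leaves \<T>" "last n = (r, s)" "r \<noteq> s" "reducers n = {}"
    and fg: "f \<in> (\<Pi>\<^sub>E t\<in>transitions N. next_pairs N t r s)"
      "g \<in> (\<Pi>\<^sub>E t\<in>transitions N. next_pairs N t s r)"
    and N: "transitions N \<noteq> {}"
    and \<T>': "\<T>' = \<T> \<union> {n @ [y] | y. y \<in> f ` transitions N \<union> g ` transitions N}"
  shows "alg_tree N x \<T>' \<and> \<T> \<subset> \<T>'"
proof -
  let ?X = "f ` transitions N \<union> g ` transitions N"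
  have "\<forall>y \<in> ?X. child_label N n y"
    using n PiE_mem[OF fg(1)] PiE_mem[OF fg(2)] by (fastforce simp: child_label_def)
  moreover have "expanded N \<T>' n"
    unfolding expanded_def n(2) prod.case
  proof
    fix t assume t: "t \<in> transitions N"
    then have "f t \<in> next_pairs N t r s" "g t \<in> next_pairs N t s r"
      using fg by (auto dest: PiE_mem)
    moreover have "n @ [f t] \<in> \<T>'" "n @ [g t] \<in> \<T>'"
      unfolding \<T>' using t by blast+
    ultimately show "(\<exists>y \<in> next_pairs N t r s. n @ [y] \<in> \<T>') \<and> (\<exists>y \<in> next_pairs N t s r. n @ [y] \<in> \<T>')"
      by blast
  qed
  ultimately show ?thesis
    using alg_tree_extend[OF \<T> n(1) _ _ \<T>'] N by blast
qed

section \<open>Invariant, measure and progress of a run\<close>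

text \<open>In the NO case the leaf is also recorded as no identity-node, which makes the tree not
  successful.\<close>

definition config_ok :: "('p::linorder, 't, 'a) petri_net \<Rightarrow> 'p rpair \<Rightarrow> 'p config \<Rightarrow> bool" where
  "config_ok N x c \<longleftrightarrow> (case c of
     Running \<T> \<Rightarrow> alg_tree N x \<T>
   | Stopped \<T> a \<Rightarrow> alg_tree N x \<T> \<and>
       (if a = YES then successful \<T>
        else \<exists>n \<in> leaves \<T>. unsuccessful_leaf N n \<and> \<not> identity_node n))"

text \<open>\<open>Suc\<close> pays for the final step, which stops the run without adding a
  node.\<close>

definition steps_left :: "'p node set \<Rightarrow> 'p config \<Rightarrow> nat" where
  "steps_left U c = (case c of Running \<T> \<Rightarrow> Suc (card (U - \<T>)) | Stopped \<T> a \<Rightarrow> 0)"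

lemma alg_step_config:
  assumes N: "transitions N \<noteq> {}" and fin: "finite (node_universe N [x])"
    and step: "alg_step N c m c'" and ok: "config_ok N x c"
  shows "config_ok N x c' \<and> steps_left (node_universe N [x]) c' < steps_left (node_universe N [x]) c"
proof -
  have grow: "config_ok N x (Running \<T>') \<and> steps_left (node_universe N [x]) (Running \<T>')
      < steps_left (node_universe N [x]) (Running \<T>)"
    if "alg_tree N x \<T>' \<and> \<T> \<subset> \<T>'" for \<T> \<T>'
  proof -
    have "node_universe N [x] - \<T>' \<subset> node_universe N [x] - \<T>"
      using that alg_treeD(2) by blast
    then have "card (node_universe N [x] - \<T>') < card (node_universe N [x] - \<T>)"
      by (rule psubset_card_mono[rotated]) (use fin in simp)
    with that show ?thesis
      by (simp add: config_ok_def steps_left_def)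
  qed
  show ?thesis
    using step ok
  proof cases
    case (reduce_right n \<T> r s n' r' s')
    then have "alg_tree N x \<T>" using ok by (simp add: config_ok_def)
    moreover have "r' \<noteq> s'"
      using reduce_right(9) smaller_irrefl by blast
    ultimately show ?thesis
      unfolding reduce_right(1,3)
      using reduce_right grow[OF alg_tree_reduce[of N x \<T> n n', OF _ _ _ _ _ refl]]
      by (simp add: reduction_right)
  next
    case (reduce_left n \<T> r s n' r' s')
    then have "alg_tree N x \<T>" using ok by (simp add: config_ok_def)
    moreover have "r' \<noteq> s'"
      using reduce_left(9) smaller_irrefl by blast
    ultimately show ?thesis
      unfolding reduce_left(1,3)
      using reduce_left grow[OF alg_tree_reduce[of N x \<T> n n', OF _ _ _ _ _ refl]]
      by (simp add: reduction_left)
  next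
    case (expand n \<T> r s f g)
    then have "alg_tree N x \<T>" using ok by (simp add: config_ok_def)
    then show ?thesis
      unfolding expand(1,3)
      using grow[OF alg_tree_expand[of N x \<T> n r s f g, OF _ expand(4-7,9,10) N refl]] by blast
  next
    case (reject n \<T> r s)
    then have "unsuccessful_leaf N n \<and> \<not> identity_node n"
      by (simp add: unsuccessful_leaf_def identity_node_def)
    with reject show ?thesis
      using ok by (auto simp: config_ok_def steps_left_def)
  qed (auto simp: config_ok_def steps_left_def)
qed

lemma alg_step_from_Stopped: "\<not> alg_step N (Stopped \<T> a) m c"
  by (auto elim: alg_step.cases)

text \<open>The set \<open>G\<close> of admissible labels is instantiated with all pairs, to show that a run cannot
  get stuck, and with resource bisimilarity, to show that a good run exists.\<close>

lemma alg_progress: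
  assumes N: "labeled_petri_net N" and x: "x \<in> resources N \<times> resources N"
    and \<T>: "alg_tree N x \<T>" and labels: "last ` \<T> \<subseteq> G"
    and reduce: "\<And>y y'. \<lbrakk>y \<in> G; y' \<in> G; pair_le y' y; y \<in> resources N \<times> resources N\<rbrakk>
      \<Longrightarrow> reduction y y' \<in> G"
    and expand: "\<And>r s t. \<lbrakk>(r, s) \<in> G; (r, s) \<in> bisimilar1 N; t \<in> transitions N\<rbrakk>
      \<Longrightarrow> (\<exists>y \<in> next_pairs N t r s. y \<in> G) \<and> (\<exists>y \<in> next_pairs N t s r. y \<in> G)"
  shows "\<exists>m c. alg_step N (Running \<T>) m c \<and>
    (case c of Running \<T>' \<Rightarrow> last ` \<T>' \<subseteq> G | Stopped \<T>' a \<Rightarrow> a = YES \<or> \<not> G \<subseteq> bisimilar1 N)"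
proof (cases "successful \<T>")
  case True
  then show ?thesis using alg_step.accept[of \<T> N] by fastforce
next
  case False
  then obtain n where n: "n \<in> leaves \<T>" "\<not> identity_node n"
    by (auto simp: successful_def)
  then obtain r s where rs: "last n = (r, s)" "r \<noteq> s"
    by (cases "last n") (auto simp: identity_node_def)
  have n\<T>: "n \<in> \<T>" using n(1) by (simp add: leaves_def)
  then have G: "(r, s) \<in> G" using labels rs(1) by (metis image_eqI subsetD)
  have res: "(r, s) \<in> resources N \<times> resources N"
    using resource_node_last[OF alg_tree_resource_node[OF N x \<T> n\<T>]] rs by simp
  show ?thesis
  proof (cases "reducers n = {}")
    case False
    then obtain n' where n': "n' \<in> reducers n" by blast
    obtain r' s' where rs': "last n' = (r', s')" by force
    have n'\<T>: "n' \<in> \<T>"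
      using alg_treeD(3)[OF \<T> n\<T>] reducersD(1,2)[OF n'] by (auto simp: strict_prefix_def)
    \<comment> \<open>The reducer has a child on the way to \<open>n\<close>, so its components
      differ and one of the two reduction rules applies.\<close>
    obtain y ys where "n = n' @ y # ys"
      using reducersD(2)[OF n'] by (auto elim: strict_prefixE')
    then have "n' @ [y] \<in> \<T>"
      using alg_treeD(3)[OF \<T> n\<T>, of "n' @ [y]"] by auto
    then have "child_label N n' y"
      using alg_treeD(2)[OF \<T>] node_universe_child_label reducersD(1)[OF n'] by blast
    then have ne: "r' \<noteq> s'"
      by (auto simp: child_label_def rs')
    have red: "reduction (r, s) (r', s') \<in> G"
      using reduce[of "(r, s)" "(r', s')"] G n'\<T> labels rs' reducersD(3)[OF n'] res rs(1)
      by (metis image_eqI subsetD)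
    have lab: "last ` (\<T> \<union> {n @ [reduction (r, s) (r', s')]}) \<subseteq> G"
      using labels red by auto
    consider "smaller r' s'" | "smaller s' r'" using smaller_total[OF ne] by blast
    then show ?thesis
    proof cases
      case 1
      with lab show ?thesis
        using alg_step.reduce_right[OF n(1) rs n' rs' 1, of N] by (fastforce simp: reduction_right)
    next
      case 2
      with lab show ?thesis
        using alg_step.reduce_left[OF n(1) rs n' rs' 2, of N] by (fastforce simp: reduction_left)
    qed
  next
    case True
    show ?thesis
    proof (cases "(r, s) \<in> bisimilar1 N")
      case False
      \<comment> \<open>A rejection exhibits a label in \<open>G\<close> outside
        \<open>bisimilar1 N\<close>.\<close>
      with G show ?thesis
        using alg_step.reject[OF n(1) rs True False] by (metis config.simps(6) subsetD)
    next
      case b: True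
      have "\<forall>t \<in> transitions N. \<exists>y. y \<in> next_pairs N t r s \<inter> G"
        "\<forall>t \<in> transitions N. \<exists>y. y \<in> next_pairs N t s r \<inter> G"
        using expand[OF G b] by blast+
      then obtain f g where fg: "\<forall>t \<in> transitions N. f t \<in> next_pairs N t r s \<inter> G"
        "\<forall>t \<in> transitions N. g t \<in> next_pairs N t s r \<inter> G"
        by (metis bchoice)
      \<comment> \<open>The extensional function space demands \<open>undefined\<close> outside
        \<open>transitions N\<close>.\<close>
      let ?f = "restrict f (transitions N)" and ?g = "restrict g (transitions N)"
      let ?\<T> = "\<T> \<union> {n @ [y] | y. y \<in> ?f ` transitions N \<union> ?g ` transitions N}"
      have "?f \<in> (\<Pi>\<^sub>E t\<in>transitions N. next_pairs N t r s)"
        "?g \<in> (\<Pi>\<^sub>E t\<in>transitions N. next_pairs N t s r)"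
        using fg by auto
      then have "alg_step N (Running \<T>) (Expand n ?f ?g) (Running ?\<T>)"
        by (rule alg_step.expand[OF n(1) rs True b])
      moreover have "last ` ?\<T> \<subseteq> G"
        using fg labels by auto
      ultimately show ?thesis
        by (metis (no_types, lifting) config.simps(5))
    qed
  qed
qed

section \<open>Length and number of computations\<close>

lemma computation_step:
  assumes "computation N r s \<rho>"
  shows "snd (\<rho> i) = Some m \<Longrightarrow> alg_step N (fst (\<rho> i)) m (fst (\<rho> (Suc i)))"
    "snd (\<rho> i) = None \<Longrightarrow> \<rho> (Suc i) = \<rho> i"
    "snd (\<rho> i) = None \<Longrightarrow> \<not> alg_step N (fst (\<rho> i)) m c"
  using assms unfolding computation_def by (force split: option.splits)+

lemma computation_config_ok:
  assumes "transitions N \<noteq> {}" "finite (node_universe N [(r, s)])" "computation N r s \<rho>"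
  shows "config_ok N (r, s) (fst (\<rho> i))"
proof (induction i)
  case 0
  then show ?case
    using assms(3) alg_tree_singleton[of N "(r, s)"] by (simp add: computation_def config_ok_def)
next
  case (Suc i)
  then show ?case
    using alg_step_config[OF assms(1,2)] computation_step(1,2)[OF assms(3), of i]
    by (cases "snd (\<rho> i)") auto
qed

text \<open>\<open>K\<close> is the same for all computations, which is what makes it usable for
  counting them.\<close>

lemma computation_stable:
  assumes "transitions N \<noteq> {}" "finite (node_universe N [(r, s)])"
  defines "K \<equiv> Suc (steps_left (node_universe N [(r, s)]) (Running {[(r, s)]}))"
  assumes "computation N r s \<rho>" "i \<ge> K"
  shows "snd (\<rho> i) = None" "\<rho> i = \<rho> K"
proof -
  let ?U = "node_universe N [(r, s)]"
  \<comment> \<open>While the run moves, each step lowers the measure by at least one, so index plus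
    measure never exceeds the initial measure \<open>K - 1\<close>.\<close>
  have bound: "snd (\<rho> j) = None \<or> steps_left ?U (fst (\<rho> j)) + j < K" for j
  proof (induction j)
    case 0
    then show ?case using assms(4) by (simp add: computation_def K_def)
  next
    case (Suc j)
    then show ?case
      using alg_step_config[OF assms(1,2) _ computation_config_ok[OF assms(1,2,4)]]
        computation_step(1,2)[OF assms(4), of j]
      by (cases "snd (\<rho> j)") fastforce+
  qed
  have "snd (\<rho> j) = None" if "j \<ge> K" for j
    using bound[of j] that by auto
  then have "\<rho> (K + j) = \<rho> K" for j
    using computation_step(2)[OF assms(4)] by (induction j) auto
  then show "\<rho> i = \<rho> K" using assms(5) by (metis le_add_diff_inverse)
  show "snd (\<rho> i) = None" using bound[of i] assms(5) by auto
qed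

text \<open>Once no move is made, the configuration is stopped, because a running one always has a
  step: \<open>alg_progress\<close> with all pairs admissible.\<close>

lemma computation_finishes:
  assumes N: "labeled_petri_net N" "transitions N \<noteq> {}" and x: "(r, s) \<in> resources N \<times> resources N"
    and comp: "computation N r s \<rho>"
  shows "\<exists>i \<T> a. \<rho> i = (Stopped \<T> a, None) \<and> config_ok N (r, s) (Stopped \<T> a)"
proof -
  have fin: "finite (node_universe N [(r, s)])"
    using finite_node_universe[OF N(1), of "[(r, s)]"] x by (auto simp: resource_node_def)
  obtain i where i: "snd (\<rho> i) = None"
    using computation_stable(1)[OF N(2) fin comp] by blast
  have ok: "config_ok N (r, s) (fst (\<rho> i))"
    using computation_config_ok[OF N(2) fin comp] .
  have "\<exists>\<T> a. fst (\<rho> i) = Stopped \<T> a"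
  proof (cases "fst (\<rho> i)")
    case (Running \<T>)
    then have \<T>: "alg_tree N (r, s) \<T>" using ok by (simp add: config_ok_def)
    have "(\<exists>y \<in> next_pairs N t a b. y \<in> UNIV) \<and> (\<exists>y \<in> next_pairs N t b a. y \<in> UNIV)"
      if "(a, b) \<in> bisimilar1 N" "t \<in> transitions N" for a b t
      using next_pairs_bisimilar1[OF that] next_pairs_bisimilar1[OF bisimilar1_sym[OF that(1)] that(2)]
      by auto
    then have "\<exists>m c. alg_step N (Running \<T>) m c"
      using alg_progress[OF N(1) x \<T>, of UNIV] by (metis UNIV_I top_greatest)
    then show ?thesis using computation_step(3)[OF comp i] Running by auto
  qed auto
  then show ?thesis using i ok by (metis prod.collapse)
qed

definition run_moves :: "('p::linorder, 't, 'a) petri_net \<Rightarrow> 'p node set \<Rightarrow> ('p, 't) move set" where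
  "run_moves N U = insert Accept ((\<lambda>(n, n'). Reduce n n') ` (U \<times> U) \<union> Reject ` U \<union>
     (\<Union>n \<in> U. (\<lambda>(f, g). Expand n f g) `
       ((\<Pi>\<^sub>E t\<in>transitions N. next_pairs N t (fst (last n)) (snd (last n))) \<times>
        (\<Pi>\<^sub>E t\<in>transitions N. next_pairs N t (snd (last n)) (fst (last n))))))"

lemma finite_run_moves:
  assumes "labeled_petri_net N" "finite U"
  shows "finite (run_moves N U)"
  using assms finite_next_pairs[OF assms(1)]
  by (auto simp: run_moves_def labeled_petri_net_def intro!: finite_PiE finite_cartesian_product)

lemma alg_step_run_moves:
  assumes \<T>: "alg_tree N x \<T>" and step: "alg_step N (Running \<T>) m c"
  shows "m \<in> run_moves N (node_universe N [x])"
proof -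
  have leaf: "n \<in> node_universe N [x]" if "n \<in> leaves \<T>" for n
    using that alg_treeD(2)[OF \<T>] by (auto simp: leaves_def)
  have red: "n' \<in> node_universe N [x]" if "n \<in> leaves \<T>" "n' \<in> reducers n" for n n'
    using that reducersD(1,2)[of n' n] alg_treeD(2,3)[OF \<T>]
    by (auto simp: leaves_def strict_prefix_def)
  show ?thesis
    using step
  proof cases
    case (expand n r s f g)
    then have "(f, g) \<in> (\<Pi>\<^sub>E t\<in>transitions N. next_pairs N t (fst (last n)) (snd (last n))) \<times>
        (\<Pi>\<^sub>E t\<in>transitions N. next_pairs N t (snd (last n)) (fst (last n)))"
      by simp
    then show ?thesis
      unfolding run_moves_def expand(1)
      by (intro insertI2 UnI2 UN_I[OF leaf[OF expand(3)]] image_eqI[where x = "(f, g)"]) simp_all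
  qed (use leaf red in \<open>auto simp: run_moves_def\<close>)
qed

text \<open>A computation is constant from \<open>K\<close> on, hence determined by its restriction
  to \<open>{..K}\<close>, a function into a finite set of configurations and moves.\<close>

lemma finite_computations:
  assumes N: "labeled_petri_net N" "transitions N \<noteq> {}" and x: "(r, s) \<in> resources N \<times> resources N"
  shows "finite {\<rho>. computation N r s \<rho>}"
proof -
  let ?U = "node_universe N [(r, s)]"
  have fin: "finite ?U"
    using finite_node_universe[OF N(1), of "[(r, s)]"] x by (auto simp: resource_node_def)
  define K where "K = Suc (steps_left ?U (Running {[(r, s)]}))"
  define A where "A = (Running ` Pow ?U \<union> (\<lambda>(\<T>, a). Stopped \<T> a) ` (Pow ?U \<times> {YES, NO})) \<times>
    insert None (Some ` run_moves N ?U)"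
  have A: "finite A"
    unfolding A_def using fin finite_run_moves[OF N(1) fin] by simp
  have ran: "\<rho> i \<in> A" if \<rho>: "computation N r s \<rho>" for \<rho> i
  proof -
    have ok: "config_ok N (r, s) (fst (\<rho> i))"
      using computation_config_ok[OF N(2) fin \<rho>] .
    have "fst (\<rho> i) \<in> Running ` Pow ?U \<union> (\<lambda>(\<T>, a). Stopped \<T> a) ` (Pow ?U \<times> {YES, NO})"
    proof (cases "fst (\<rho> i)")
      case (Stopped \<T> a)
      then have "(\<T>, a) \<in> Pow ?U \<times> {YES, NO}"
        using ok alg_treeD(2)[of N "(r, s)" \<T>] by (cases a) (auto simp: config_ok_def)
      then show ?thesis using Stopped by force
    qed (use ok alg_treeD(2)[of N "(r, s)"] in \<open>auto simp: config_ok_def\<close>)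
    moreover have "snd (\<rho> i) \<in> insert None (Some ` run_moves N ?U)"
    proof (cases "snd (\<rho> i)")
      case (Some m)
      then have step: "alg_step N (fst (\<rho> i)) m (fst (\<rho> (Suc i)))"
        by (rule computation_step(1)[OF \<rho>])
      then obtain \<T> where "fst (\<rho> i) = Running \<T>"
        by (auto elim: alg_step.cases)
      then show ?thesis
        using alg_step_run_moves[of N "(r, s)" \<T>] step ok Some by (auto simp: config_ok_def)
    qed simp
    ultimately show ?thesis
      unfolding A_def by (simp add: mem_Times_iff)
  qed
  have "inj_on (\<lambda>\<rho>. restrict \<rho> {..K}) {\<rho>. computation N r s \<rho>}"
  proof (rule inj_onI, rule ext)
    fix \<rho> \<rho>' i
    assume "\<rho> \<in> {\<rho>. computation N r s \<rho>}" "\<rho>' \<in> {\<rho>. computation N r s \<rho>}"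
      and "restrict \<rho> {..K} = restrict \<rho>' {..K}"
    then have c: "computation N r s \<rho>" "computation N r s \<rho>'"
      and eq: "\<And>j. j \<le> K \<Longrightarrow> \<rho> j = \<rho>' j"
      by (auto dest: fun_cong split: if_splits simp: restrict_def)
    show "\<rho> i = \<rho>' i"
    proof (cases "i \<le> K")
      case False
      then have "\<rho> i = \<rho> K" "\<rho>' i = \<rho>' K"
        using computation_stable(2)[OF N(2) fin c(1), of i]
          computation_stable(2)[OF N(2) fin c(2), of i] by (auto simp: K_def)
      then show ?thesis using eq by simp
    qed (rule eq)
  qed
  moreover have "(\<lambda>\<rho>. restrict \<rho> {..K}) ` {\<rho>. computation N r s \<rho>} \<subseteq> (\<Pi>\<^sub>E i\<in>{..K}. A)"
    using ran by (auto simp: restrict_PiE_iff split: if_splits)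
  moreover have "finite (\<Pi>\<^sub>E i\<in>{..K}. A)"
    using A by (intro finite_PiE) auto
  ultimately show ?thesis
    by (meson finite_imageD finite_subset)
qed

section \<open>Soundness and completeness\<close>

text \<open>One selected pair per transition is enough, since the firing of \<open>t\<close> has a
  unique result.\<close>

lemma resource_transfer_next_pairs:
  assumes "\<And>r s t. (r, s) \<in> R \<Longrightarrow> t \<in> transitions N \<Longrightarrow> \<exists>y \<in> next_pairs N t r s. y \<in> C"
  shows "resource_transfer N R C"
  unfolding resource_transfer_def
proof clarify
  fix r s t r'
  assume rs: "(r, s) \<in> R" and t: "t \<in> transitions N" and r': "fires N (r + (pre N t - r)) t r'"
  obtain r1 s1 u where "fires N (r + (pre N t - r)) t r1" "u \<in> transitions N"
    "label N u = label N t" "fires N (s + (pre N t - r)) u s1" "(r1, s1) \<in> C"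
    using assms[OF rs t] unfolding next_pairs_def by blast
  moreover from this(1) r' have "r1 = r'"
    by (simp add: fires_def)
  ultimately show "\<exists>u\<in>transitions N. \<exists>s'. fires N (s + (pre N t - r)) u s' \<and>
      label N u = label N t \<and> (r', s') \<in> C"
    by blast
qed

text \<open>Only at these nodes do the children witness the transfer property; the other labels must
  be derived in the closure.\<close>

definition expanded_labels :: "('p, 't, 'a) petri_net \<Rightarrow> 'p tree \<Rightarrow> 'p rpair set" where
  "expanded_labels N \<T> = last ` {n \<in> \<T>. expanded N \<T> n}"

text \<open>
  Induction from the root downwards. From a reduced node \<open>n\<close> follow the reductions down to a node
  that is expanded or an identity-node. The labels strictly decrease along this chain, so no node of
  the chain serves as a reducer in it: all reducers lie properly above \<open>n\<close>.
\<close>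

lemma label_in_congruence_closure:
  assumes N: "labeled_petri_net N" and x: "x \<in> resources N \<times> resources N"
    and \<T>: "alg_tree N x \<T>" and succ: "successful \<T>" and "n \<in> \<T>"
  shows "last n \<in> congruence_closure N (expanded_labels N \<T>)"
  using \<open>n \<in> \<T>\<close>
proof (induction n rule: measure_induct_rule[of length])
  case (less n)
  let ?C = "congruence_closure N (expanded_labels N \<T>)"
  \<comment> \<open>The outer induction passes to shorter nodes, the inner one to descendants. The
    premise on \<open>k\<close> places the label of \<open>m\<close> below those of all earlier
    nodes from \<open>n\<close> on.\<close>
  have "last m \<in> ?C" if "m \<in> \<T>" "prefix n m"
    "\<And>k. prefix n k \<Longrightarrow> strict_prefix k m \<Longrightarrow> decreases (last m) (last k)" for m
    using wf_child_label[OF N] that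
  proof (induction m rule: wf_induct_rule)
    case (less m)
    note node = alg_tree_resource_node[OF N x \<T> less.prems(1)]
    note res = resource_node_last[OF node]
    consider "m \<in> leaves \<T>" | "expanded N \<T> m" | "reduced \<T> m"
      using alg_treeD(4)[OF \<T> less.prems(1)] by (elim disjE)
    then show ?case
    proof cases
      case 1
      then obtain r where "last m = (r, r)"
        using succ by (auto simp: successful_def identity_node_def)
      then show ?thesis using res by (auto intro: congruence_closure.reflexive)
    next
      case 2
      then have "last m \<in> expanded_labels N \<T>"
        using less.prems(1) by (auto simp: expanded_labels_def)
      then show ?thesis by (metis congruence_closure.base surj_pair)
    next
      case 3
      then obtain n' where n': "n' \<in> reducers m" and child: "m @ [reduction (last m) (last n')] \<in> \<T>"
        by (auto simp: reduced_def)
      let ?x = "reduction (last m) (last n')"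
      note n'D = reducersD[OF n']
      have m: "m \<noteq> []" using node by (simp add: resource_node_def)
      have n'\<T>: "n' \<in> \<T>"
        using alg_treeD(3)[OF \<T> less.prems(1)] n'D by (auto simp: strict_prefix_def)
      obtain y ys where "m = n' @ y # ys"
        using n'D(2) by (auto elim: strict_prefixE')
      then have "n' @ [y] \<in> \<T>"
        using alg_treeD(3)[OF \<T> less.prems(1), of "n' @ [y]"] by auto
      then have "child_label N n' y"
        using alg_treeD(2)[OF \<T>] node_universe_child_label n'D(1) by blast
      then have "fst (last n') \<noteq> snd (last n')"
        by (auto simp: child_label_def)
      then have dec: "decreases ?x (last m)"
        using reduction_decreases n'D(3) by blast
      \<comment> \<open>Otherwise the label of \<open>m\<close> would lie strictly below that of
        \<open>n'\<close> and yet dominate it.\<close>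
      have "\<not> prefix n n'"
        using less.prems(3)[OF _ n'D(2)] n'D(3) decreases_not_pair_le by blast
      moreover have "prefix n n' \<or> prefix n' n"
        using n'D(2) less.prems(2) prefix_same_cases by (auto simp: strict_prefix_def)
      ultimately have "strict_prefix n' n"
        by (auto simp: strict_prefix_def)
      then have above: "last n' \<in> ?C"
        using \<open>\<And>y. length y < length n \<Longrightarrow> y \<in> \<T> \<Longrightarrow> last y \<in> ?C\<close> n'\<T> prefix_length_less by blast
      have "last (m @ [?x]) \<in> ?C"
      proof (rule less.IH)
        show "(m @ [?x], m) \<in> {(n @ [x], n) | n x. resource_node N n \<and> child_label N n x}"
          using node node_universe_child_label[OF _ m] child alg_treeD(2)[OF \<T>] by blast
        show "prefix n (m @ [?x])" using less.prems(2) by (simp add: prefix_snoc)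
        fix k assume k: "prefix n k" "strict_prefix k (m @ [?x])"
        then consider "k = m" | "strict_prefix k m"
          by (auto simp: strict_prefix_def prefix_snoc)
        then show "decreases (last (m @ [?x])) (last k)"
          using dec decreases_trans[OF dec less.prems(3)[OF k(1)]] by cases auto
      qed (rule child)
      then show ?thesis
        using reduction_congruence[OF above n'D(3) res] by simp
    qed
  qed
  \<comment> \<open>For \<open>m = n\<close> the premise on \<open>k\<close> is vacuous.\<close>
  from this[OF less.prems(1)] show ?case
    by (meson prefix_order.leD prefix_order.refl)
qed

lemma successful_imp_bisimilar:
  assumes N: "labeled_petri_net N" and x: "x \<in> resources N \<times> resources N"
    and \<T>: "alg_tree N x \<T>" and succ: "successful \<T>"
  shows "x \<in> bisimilarity N"
proof -
  let ?E = "expanded_labels N \<T>"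
  let ?C = "congruence_closure N ?E"
  note inC = label_in_congruence_closure[OF N x \<T> succ]
  have next_E: "(\<exists>y \<in> next_pairs N t r s. y \<in> ?C) \<and> (\<exists>y \<in> next_pairs N t s r. y \<in> ?C)"
    if rs: "(r, s) \<in> ?E" and t: "t \<in> transitions N" for r s t
  proof -
    obtain n where "last n = (r, s)" "expanded N \<T> n"
      using rs by (fastforce simp: expanded_labels_def)
    then obtain y z where "y \<in> next_pairs N t r s" "n @ [y] \<in> \<T>" "z \<in> next_pairs N t s r" "n @ [z] \<in> \<T>"
      using t by (auto simp: expanded_def)
    then show ?thesis using inC[of "n @ [y]"] inC[of "n @ [z]"] by auto
  qed
  have "?E \<subseteq> resources N \<times> resources N"
    using resource_node_last[OF alg_tree_resource_node[OF N x \<T>]]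
    unfolding expanded_labels_def by (intro image_subsetI) simp
  moreover have "resource_transfer N ?E ?C"
    by (rule resource_transfer_next_pairs) (use next_E in blast)
  moreover have "resource_transfer N (?E\<inverse>) ?C"
    by (rule resource_transfer_next_pairs) (use next_E in blast)
  ultimately have "resource_bisimulation N ?C"
    by (rule resource_bisimulation_congruence_closure[OF N])
  moreover have "x \<in> ?C"
    using inC[OF alg_treeD(1)[OF \<T>]] by simp
  ultimately show ?thesis
    by (cases x) (auto simp: bisimilarity_def resource_bisimilar_def)
qed

section \<open>Existence of an accepting computation\<close>

definition bisimilar_config :: "('p::linorder, 't, 'a) petri_net \<Rightarrow> 'p rpair \<Rightarrow> 'p config \<Rightarrow> bool" where
  "bisimilar_config N x c \<longleftrightarrow> config_ok N x c \<and>
     (case c of Running \<T> \<Rightarrow> last ` \<T> \<subseteq> bisimilarity N | Stopped \<T> a \<Rightarrow> a = YES)"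

lemma bisimilar_config_progress:
  assumes N: "labeled_petri_net N" "transitions N \<noteq> {}" and x: "x \<in> resources N \<times> resources N"
    and c: "bisimilar_config N x (Running \<T>)"
  shows "\<exists>m c'. alg_step N (Running \<T>) m c' \<and> bisimilar_config N x c'"
proof -
  have fin: "finite (node_universe N [x])"
    using finite_node_universe[OF N(1), of "[x]"] x by (simp add: resource_node_def)
  have \<T>: "alg_tree N x \<T>" and lab: "last ` \<T> \<subseteq> bisimilarity N"
    and ok: "config_ok N x (Running \<T>)"
    using c by (auto simp: bisimilar_config_def config_ok_def)
  have "\<exists>m c'. alg_step N (Running \<T>) m c' \<and> (case c' of Running \<T>' \<Rightarrow> last ` \<T>' \<subseteq> bisimilarity N
      | Stopped \<T>' a \<Rightarrow> a = YES \<or> \<not> bisimilarity N \<subseteq> bisimilar1 N)"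
  proof (rule alg_progress[OF N(1) x \<T> lab])
    show "reduction y y' \<in> bisimilarity N"
      if "y \<in> bisimilarity N" "y' \<in> bisimilarity N" "pair_le y' y" "y \<in> resources N \<times> resources N" for y y'
      using reduction_congruence[of y' N "bisimilarity N" y] that
      by (simp add: congruence_closure_bisimilarity[OF N(1)])
    show "(\<exists>y \<in> next_pairs N t r s. y \<in> bisimilarity N) \<and> (\<exists>y \<in> next_pairs N t s r. y \<in> bisimilarity N)"
      if "(r, s) \<in> bisimilarity N" "(r, s) \<in> bisimilar1 N" "t \<in> transitions N" for r s t
      using next_pairs_bisimilarity[OF that(1,3)]
        next_pairs_bisimilarity[OF bisimilarity_sym[OF that(1)] that(3)] by simp
  qed
  then obtain m c' where step: "alg_step N (Running \<T>) m c'"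
    and labels: "case c' of Running \<T>' \<Rightarrow> last ` \<T>' \<subseteq> bisimilarity N
      | Stopped \<T>' a \<Rightarrow> a = YES \<or> \<not> bisimilarity N \<subseteq> bisimilar1 N"
    by blast
  have "case c' of Running \<T>' \<Rightarrow> last ` \<T>' \<subseteq> bisimilarity N | Stopped \<T>' a \<Rightarrow> a = YES"
    using labels bisimilarity_subset_bisimilar1[of N] by (cases c') simp_all
  moreover have "config_ok N x c'"
    using alg_step_config[OF N(2) fin step ok] by simp
  ultimately show ?thesis
    using step unfolding bisimilar_config_def by blast
qed

lemma bisimilar_imp_successful_computation:
  fixes N :: "('p::linorder, 't, 'a) petri_net"
  assumes N: "labeled_petri_net N" "transitions N \<noteq> {}" and x: "(r, s) \<in> resources N \<times> resources N"
    and "(r, s) \<in> bisimilarity N"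
  shows "\<exists>\<rho> \<T>. computation N r s \<rho> \<and> finishes_with \<rho> \<T> YES \<and> successful \<T>"
proof -
  let ?init = "Running {[(r, s)]}"
  \<comment> \<open>A computation pairs a configuration with its move, so the move is fixed before
    the next configuration; \<open>good\<close> therefore promises that this move can lead to a
    bisimilar configuration.\<close>
  define good where "good z \<longleftrightarrow> bisimilar_config N (r, s) (fst z) \<and> (case snd z of
      Some m \<Rightarrow> \<exists>c'. alg_step N (fst z) m c' \<and> bisimilar_config N (r, s) c'
    | None \<Rightarrow> \<nexists>m c. alg_step N (fst z) m c)" for z :: "'p config \<times> ('p, 't) move option"
  have choose: "\<exists>mo. good (c, mo)" if c: "bisimilar_config N (r, s) c" for c
  proof (cases c)
    case (Running \<T>)
    then obtain m c' where "alg_step N c m c'" "bisimilar_config N (r, s) c'"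
      using bisimilar_config_progress[OF N x] c by blast
    then have "good (c, Some m)"
      using c by (auto simp: good_def)
    then show ?thesis ..
  next
    case (Stopped \<T> a)
    then have "good (c, None)"
      using c by (simp add: good_def alg_step_from_Stopped)
    then show ?thesis ..
  qed
  have init: "bisimilar_config N (r, s) ?init"
    using assms(4) alg_tree_singleton[of N "(r, s)"] by (simp add: bisimilar_config_def config_ok_def)
  \<comment> \<open>The conjunct for \<open>i = 0\<close> fixes the start of the sequence obtained
    by dependent choice.\<close>
  have "\<exists>\<rho>. \<forall>i. (good (\<rho> i) \<and> (i = 0 \<longrightarrow> fst (\<rho> i) = ?init)) \<and> (case snd (\<rho> i) of
      Some m \<Rightarrow> alg_step N (fst (\<rho> i)) m (fst (\<rho> (Suc i))) | None \<Rightarrow> \<rho> (Suc i) = \<rho> i)"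
  proof (rule dependent_nat_choice)
    show "\<exists>z. good z \<and> (0 = (0::nat) \<longrightarrow> fst z = ?init)"
      using choose[OF init] by auto
    fix z :: "'p config \<times> ('p, 't) move option" and i :: nat
    assume z: "good z \<and> (i = 0 \<longrightarrow> fst z = ?init)"
    show "\<exists>z'. (good z' \<and> (Suc i = 0 \<longrightarrow> fst z' = ?init)) \<and>
      (case snd z of Some m \<Rightarrow> alg_step N (fst z) m (fst z') | None \<Rightarrow> z' = z)"
    proof (cases "snd z")
      case None
      then show ?thesis using z by (intro exI[of _ z]) simp
    next
      case (Some m)
      then obtain c' where "alg_step N (fst z) m c'" "bisimilar_config N (r, s) c'"
        using z by (auto simp: good_def)
      moreover obtain mo where "good (c', mo)"
        using choose calculation(2) by blast
      ultimately show ?thesis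
        using Some by (intro exI[of _ "(c', mo)"]) simp
    qed
  qed
  then obtain \<rho> where good: "\<And>i. good (\<rho> i)" and zero: "fst (\<rho> 0) = ?init"
    and step: "\<And>i. case snd (\<rho> i) of
      Some m \<Rightarrow> alg_step N (fst (\<rho> i)) m (fst (\<rho> (Suc i))) | None \<Rightarrow> \<rho> (Suc i) = \<rho> i"
    by blast
  have comp: "computation N r s \<rho>"
    unfolding computation_def
  proof (intro conjI allI zero)
    fix i
    show "case snd (\<rho> i) of Some m \<Rightarrow> alg_step N (fst (\<rho> i)) m (fst (\<rho> (Suc i)))
      | None \<Rightarrow> (\<nexists>m c. alg_step N (fst (\<rho> i)) m c) \<and> \<rho> (Suc i) = \<rho> i"
      using step[of i] good[of i] by (cases "snd (\<rho> i)") (auto simp: good_def)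
  qed
  then obtain i \<T> a where i: "\<rho> i = (Stopped \<T> a, None)" "config_ok N (r, s) (Stopped \<T> a)"
    using computation_finishes[OF N x] by blast
  moreover have "a = YES"
    using good[of i] i(1) by (simp add: good_def bisimilar_config_def)
  ultimately show ?thesis
    using comp by (auto simp: finishes_with_def config_ok_def)
qed

lemma finishes_with_config_ok:
  assumes "labeled_petri_net N" "transitions N \<noteq> {}" "(r, s) \<in> resources N \<times> resources N"
    and "computation N r s \<rho>" "finishes_with \<rho> \<T> a"
  shows "config_ok N (r, s) (Stopped \<T> a)"
proof -
  have "finite (node_universe N [(r, s)])"
    using finite_node_universe[OF assms(1), of "[(r, s)]"] assms(3) by (simp add: resource_node_def)
  then show ?thesis
    using computation_config_ok[OF assms(2) _ assms(4)] assms(5)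
    by (metis finishes_with_def fst_conv)
qed

theorem theorem4p4:
  fixes N :: "('p::linorder, 't, 'a) petri_net" and r\<^sub>0 s\<^sub>0 :: "'p multiset"
  assumes "labeled_petri_net N" and "places N \<noteq> {}" and "transitions N \<noteq> {}"
    and "r\<^sub>0 \<in> resources N" and "s\<^sub>0 \<in> resources N"
  shows "(finite {\<rho>. computation N r\<^sub>0 s\<^sub>0 \<rho>} \<and>
          (\<forall>\<rho>. computation N r\<^sub>0 s\<^sub>0 \<rho> \<longrightarrow>
             (\<exists>\<T> a. finishes_with \<rho> \<T> a \<and> finite \<T> \<and> resource_tree N (r\<^sub>0, s\<^sub>0) \<T> \<and>
                (((\<exists>n \<in> leaves \<T>. unsuccessful_leaf N n) \<and> \<not> successful \<T> \<and> a = NO) \<or>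
                 (successful \<T> \<and> \<not> (\<exists>n \<in> leaves \<T>. unsuccessful_leaf N n) \<and> a = YES)))))
       \<and> (resource_bisimilar N r\<^sub>0 s\<^sub>0 \<longleftrightarrow>
          (\<exists>\<rho> \<T> a. computation N r\<^sub>0 s\<^sub>0 \<rho> \<and> finishes_with \<rho> \<T> a \<and> successful \<T>))"
proof (intro conjI allI impI)
  have x: "(r\<^sub>0, s\<^sub>0) \<in> resources N \<times> resources N"
    using assms(4,5) by simp
  show "finite {\<rho>. computation N r\<^sub>0 s\<^sub>0 \<rho>}"
    by (rule finite_computations[OF assms(1,3) x])
  show "resource_bisimilar N r\<^sub>0 s\<^sub>0 \<longleftrightarrow>
      (\<exists>\<rho> \<T> a. computation N r\<^sub>0 s\<^sub>0 \<rho> \<and> finishes_with \<rho> \<T> a \<and> successful \<T>)"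
  proof
    assume "resource_bisimilar N r\<^sub>0 s\<^sub>0"
    then show "\<exists>\<rho> \<T> a. computation N r\<^sub>0 s\<^sub>0 \<rho> \<and> finishes_with \<rho> \<T> a \<and> successful \<T>"
      using bisimilar_imp_successful_computation[OF assms(1,3) x]
      by (simp add: bisimilarity_def) blast
  next
    assume "\<exists>\<rho> \<T> a. computation N r\<^sub>0 s\<^sub>0 \<rho> \<and> finishes_with \<rho> \<T> a \<and> successful \<T>"
    then obtain \<T> a where "config_ok N (r\<^sub>0, s\<^sub>0) (Stopped \<T> a)" "successful \<T>"
      using finishes_with_config_ok[OF assms(1,3) x] by blast
    then have "(r\<^sub>0, s\<^sub>0) \<in> bisimilarity N"
      using successful_imp_bisimilar[OF assms(1) x, of \<T>] by (simp add: config_ok_def)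
    then show "resource_bisimilar N r\<^sub>0 s\<^sub>0"
      by (simp add: bisimilarity_def)
  qed
  fix \<rho> assume "computation N r\<^sub>0 s\<^sub>0 \<rho>"
  then obtain i \<T> a where i: "\<rho> i = (Stopped \<T> a, None)" and ok: "config_ok N (r\<^sub>0, s\<^sub>0) (Stopped \<T> a)"
    using computation_finishes[OF assms(1,3) x] by blast
  then have \<T>: "alg_tree N (r\<^sub>0, s\<^sub>0) \<T>" by (simp add: config_ok_def)
  have fin: "finite \<T>"
    using finite_node_universe[OF assms(1), of "[(r\<^sub>0, s\<^sub>0)]"] alg_treeD(2)[OF \<T>] x finite_subset
    by (auto simp: resource_node_def)
  have "((\<exists>n \<in> leaves \<T>. unsuccessful_leaf N n) \<and> \<not> successful \<T> \<and> a = NO) \<or>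
      (successful \<T> \<and> \<not> (\<exists>n \<in> leaves \<T>. unsuccessful_leaf N n) \<and> a = YES)"
  proof (cases a)
    case YES
    \<comment> \<open>The two outcomes exclude each other because \<open>bisimilar1 N\<close> is
      reflexive on resources.\<close>
    have "\<not> unsuccessful_leaf N n" if "n \<in> leaves \<T>" "identity_node n" for n
    proof -
      have "last n \<in> resources N \<times> resources N"
        using alg_tree_resource_node[OF assms(1) x \<T>] resource_node_last that(1)
        by (auto simp: leaves_def simp del: mem_Sigma_iff)
      then show ?thesis
        using that(2) bisimilar1_refl[OF assms(1)]
        by (auto simp: identity_node_def unsuccessful_leaf_def)
    qed
    then show ?thesis
      using ok YES by (auto simp: config_ok_def successful_def)
  next
    case NO
    then show ?thesis
      using ok by (auto simp: config_ok_def successful_def)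
  qed
  then show "\<exists>\<T> a. finishes_with \<rho> \<T> a \<and> finite \<T> \<and> resource_tree N (r\<^sub>0, s\<^sub>0) \<T> \<and>
      (((\<exists>n \<in> leaves \<T>. unsuccessful_leaf N n) \<and> \<not> successful \<T> \<and> a = NO) \<or>
       (successful \<T> \<and> \<not> (\<exists>n \<in> leaves \<T>. unsuccessful_leaf N n) \<and> a = YES))"
    using i fin alg_tree_resource_tree[OF assms(1) x \<T>] unfolding finishes_with_def by blast
qed

end
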